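(* Assume that $\epsilon:[t_0,+\infty)\to[0,+\infty)$ is nonincreasing and continuously differentiable with $\lim_{t\to+\infty}\epsilon(t)=0$, that $\beta:[t_0,+\infty)\to(0,+\infty)$ is continuously differentiable, and that $\alpha>1$, $\theta\ge\frac{1}{\alpha-1}$, $\rho\ge 0$, $\Omega\neq\emptyset$. Assume moreover that $$t\dot\beta(t)\le\frac{1-2\theta}{\theta}\beta(t)\quad\forall t\ge t_0,\qquad \int_{t_0}^{+\infty}t\beta(t)\epsilon(t)\,dt<+\infty,\qquad \lim_{t\to+\infty}t^2\beta(t)=+\infty .$$ Let $(x,\lambda):[t_0,+\infty)\to\mathcal X\times\mathcal Y$ be a solution of System (S) and let $(x^*,\lambda^* )\in\Omega$. Then the trajectory $(x(t),\lambda(t))_{t\ge t_0}$ is bounded and the following hold. (i) $\rho\int_{t_0}^{+\infty}t\beta(t)\|Ax(t)-b\|^2dt<+\infty$, $\int_{t_0}^{+\infty}t\beta(t)\epsilon(t)\|x(t)\|^2dt<+\infty$, and $((\alpha-1)\theta-1)\int_{t_0}^{+\infty}t\left(\|\dot x(t)\|^2+\|\dot\lambda(t)\|^2\right)dt<+\infty$. (ii) As $t\to+\infty$: $\mathcal L(x(t),\lambda^* )-\mathcal L(x^*,\lambda^* )=\mathcal O\left(\frac{1}{t^2\beta(t)}\right)$, $|f(x(t))-f(x^* )|=\mathcal O\left(\frac{1}{t^2\beta(t)}\right)$, $\|Ax(t)-b\|=\mathcal O\left(\frac{1}{t^2\beta(t)}\right)$, $\|(\dot x(t),\dot\lambda(t))\|=\mathcal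 O\left(\frac1t\right)$, and $\|\nabla f(x(t))-\nabla f(x^* )\|=\mathcal O\left(\frac{1}{t\sqrt{\beta(t)}}\right)$. (iii) If, in addition, the condition $t\dot\beta(t)\le\frac{1-2\theta}{\theta}\beta(t)$ for all $t\geq t_0$ is replaced by the stronger condition $\sup_{t\ge t_0}\frac{t\dot\beta(t)}{\beta(t)}<\frac{1-2\theta}{\theta}$, then also $$\int_{t_0}^{+\infty}t\beta(t)\left(\mathcal L_\rho(x(t),\lambda^* )-\mathcal L_\rho(x^*,\lambda^* )\right)dt<+\infty,\qquad \int_{t_0}^{+\infty}t\beta(t)\|\nabla f(x(t))-\nabla f(x^* )\|^2dt<+\infty .$$
   Context: $\mathcal X,\mathcal Y$ are real Hilbert spaces; $\mathcal X\times\mathcal Y$ carries the product inner product, so $\|(x,y)\|=\sqrt{\|x\|^2+\|y\|^2}$. $A:\mathcal X\to\mathcal Y$ is a continuous linear operator with adjoint $A^T$, $b\in\mathcal Y$, and $f:\mathcal X\to\mathbb R$ is convex and continuously differentiable with $\nabla f$ Lipschitz continuous with constant $L>0$. The problem is $\min_{x\in\mathcal X} f(x)$ subject to $Ax=b$. Lagrangian: $\mathcal L(x,\lambda)=f(x)+\langle\lambda,Ax-b\rangle$. Augmented Lagrangian: $\mathcal L_\rho(x,\lambda)=\mathcal L(x,\lambda)+\frac\rho2\|Ax-b\|^2$. $\Omega$ is the set of saddle points of $\mathcal L$ (equivalently of $\mathcal L_\rho$), i.e. $(x^*,\lambda^* )\in\Omega$ iff $\nabla f(x^* )+A^T\lambda^*=0$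 and $Ax^*=b$. System (S), for $t\ge t_0>0$: $$\ddot x(t)+\frac{\alpha}{t}\dot x(t)=-\beta(t)\left(\nabla f(x(t))+A^T(\lambda(t)+\theta t\dot\lambda(t))+\rho A^T(Ax(t)-b)+\epsilon(t)x(t)\right),$$ $$\ddot\lambda(t)+\frac{\alpha}{t}\dot\lambda(t)=\beta(t)\left(A(x(t)+\theta t\dot x(t))-b\right).$$ A solution is a global (twice continuously differentiable) solution on $[t_0,+\infty)$; the system is assumed throughout to admit a unique global solution for given initial data. In (i), a product of a zero coefficient with a possibly infinite integral is read as $0$ (no assertion is made in that case). *)

theory Defs
  imports "HOL-Analysis.Analysis" "HOL-Library.Landau_Symbols"
begin

definition lagrangian ::
  "('a::real_inner \<Rightarrow> real) \<Rightarrow> ('a \<Rightarrow> 'b::real_inner) \<Rightarrow> 'b \<Rightarrow> 'a \<Rightarrow> 'b \<Rightarrow> real" where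
  "lagrangian f A b x l = f x + l \<bullet> (A x - b)"

definition aug_lagrangian ::
  "real \<Rightarrow> ('a::real_inner \<Rightarrow> real) \<Rightarrow> ('a \<Rightarrow> 'b::real_inner) \<Rightarrow> 'b \<Rightarrow> 'a \<Rightarrow> 'b \<Rightarrow> real" where
  "aug_lagrangian \<rho> f A b x l = lagrangian f A b x l + \<rho> / 2 * (norm (A x - b))\<^sup>2"

definition saddle_points :: "('a \<Rightarrow> 'b \<Rightarrow> real) \<Rightarrow> ('a \<times> 'b) set" where
  "saddle_points \<L> = {(xs, ls). (\<forall>l. \<L> xs l \<le> \<L> xs ls) \<and> (\<forall>x. \<L> xs ls \<le> \<L> x ls)}"

(* Derivatives are taken within the half-line, hence are one-sided at t0.  The library's
   adjoint is a choice operator; for bounded linear A between Hilbert spaces it is the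
   adjoint, by Riesz representation.  Here g stands for the gradient of the objective,
   and x', l' are the velocities of the two components. *)
definition solution_S ::
  "real \<Rightarrow> real \<Rightarrow> real \<Rightarrow> real \<Rightarrow> (real \<Rightarrow> real) \<Rightarrow> (real \<Rightarrow> real) \<Rightarrow>
   ('a::real_inner \<Rightarrow> 'a) \<Rightarrow> ('a \<Rightarrow> 'b::real_inner) \<Rightarrow> 'b \<Rightarrow>
   (real \<Rightarrow> 'a) \<Rightarrow> (real \<Rightarrow> 'a) \<Rightarrow> (real \<Rightarrow> 'b) \<Rightarrow> (real \<Rightarrow> 'b) \<Rightarrow> bool" where
  "solution_S t0 \<alpha> \<theta> \<rho> \<beta> \<epsilon> g A b x x' l l' \<longleftrightarrow>
     (\<exists>x'' l''.
        continuous_on {t0..} x'' \<and> continuous_on {t0..} l'' \<and>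
        (\<forall>t\<ge>t0.
           (x has_vector_derivative x' t) (at t within {t0..}) \<and>
           (x' has_vector_derivative x'' t) (at t within {t0..}) \<and>
           (l has_vector_derivative l' t) (at t within {t0..}) \<and>
           (l' has_vector_derivative l'' t) (at t within {t0..}) \<and>
           x'' t + (\<alpha> / t) *\<^sub>R x' t =
             - (\<beta> t *\<^sub>R (g (x t) + adjoint A (l t + (\<theta> * t) *\<^sub>R l' t)
                        + \<rho> *\<^sub>R adjoint A (A (x t) - b) + \<epsilon> t *\<^sub>R x t)) \<and>
           l'' t + (\<alpha> / t) *\<^sub>R l' t = \<beta> t *\<^sub>R (A (x t + (\<theta> * t) *\<^sub>R x' t) - b)))"

end

theory Submission
  imports Defs
begin

text \<open>Write \<open>z = x - x\<^sup>*\<close>, \<open>y = \<lambda> - \<lambda>\<^sup>*\<close>, \<open>w = z + \<theta> t x'\<close>, \<open>v = y + \<theta> t \<lambda>'\<close> and let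
  \<open>F\<close> be the gap of the augmented Lagrangian at \<open>\<lambda>\<^sup>*\<close>.  The energy
  \<open>\<theta>\<^sup>2 t\<^sup>2 \<beta> (F + \<epsilon> \<parallel>x\<parallel>\<^sup>2 / 2) + (\<parallel>w\<parallel>\<^sup>2 + \<parallel>v\<parallel>\<^sup>2) / 2 + ((\<alpha> - 1) \<theta> - 1) (\<parallel>z\<parallel>\<^sup>2 + \<parallel>y\<parallel>\<^sup>2) / 2\<close>
  decreases up to the integrable forcing term \<open>\<theta> t \<beta> \<epsilon> \<parallel>x\<^sup>*\<parallel>\<^sup>2 / 2\<close>, by convexity and the growth
  condition on \<open>\<beta>\<close>; the dissipated terms give the integral estimates.  Boundedness of \<open>w\<close> and \<open>v\<close>
  forces that of \<open>z\<close>, \<open>y\<close> and of \<open>t x'\<close>, \<open>t \<lambda>'\<close>, even when the last coefficient vanishes.  The rate for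
  \<open>\<parallel>A x - b\<parallel>\<close> comes from the multiplier equation, a scalar-damped linear equation for \<open>t\<^sup>2 \<beta> A z\<close>,
  and the gradient estimates from cocoercivity.\<close>

section \<open>One-sided derivatives, barriers and integrability on a half-line\<close>

lemma has_real_derivative_nonpos_imp_le:
  fixes \<phi> \<phi>' :: "real \<Rightarrow> real"
  assumes "a \<le> c"
    and "\<And>t. a \<le> t \<Longrightarrow> t \<le> c \<Longrightarrow> (\<phi> has_real_derivative \<phi>' t) (at t within {a..c})"
    and "\<And>t. a < t \<Longrightarrow> t < c \<Longrightarrow> \<phi>' t \<le> 0"
  shows "\<phi> c \<le> \<phi> a"
proof -
  have "continuous_on {a..c} \<phi>"
    using assms(2) by (intro DERIV_continuous_on) auto
  moreover have "DERIV \<phi> t :> \<phi>' t" if "a < t" "t < c" for t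
    using assms(2)[of t] that by (simp add: at_within_Icc_at)
  ultimately show ?thesis
    using assms(1,3) DERIV_nonpos_imp_decreasing_open[of a c \<phi>] by (cases "a = c") auto
qed

text \<open>Past the last time at which \<open>\<phi>\<close> is at most the bound, \<open>\<phi>\<close> is nonincreasing.\<close>

lemma barrier_bound:
  fixes \<phi> \<phi>' :: "real \<Rightarrow> real"
  assumes der: "\<And>t. t \<ge> t0 \<Longrightarrow> (\<phi> has_real_derivative \<phi>' t) (at t within {t0..})"
    and barrier: "\<And>t. t \<ge> t0 \<Longrightarrow> \<phi> t \<ge> m \<Longrightarrow> \<phi>' t \<le> 0"
    and "t \<ge> t0"
  shows "\<phi> t \<le> max m (\<phi> t0)"
proof (rule ccontr)
  define M where "M = max m (\<phi> t0)"
  assume "\<not> \<phi> t \<le> max m (\<phi> t0)"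
  then have gt: "\<phi> t > M" unfolding M_def by (simp only: not_le)
  \<comment> \<open>As \<open>M\<close> dominates \<open>\<phi> t0\<close>, \<open>S\<close>
    contains \<open>t0\<close>; as it dominates \<open>m\<close>, the barrier hypothesis applies at
    all times strictly between \<open>Sup S\<close> and \<open>t\<close>.\<close>
  define S where "S = {s \<in> {t0..t}. \<phi> s \<le> M}"
  have cont: "continuous_on {t0..t} \<phi>"
    by (rule DERIV_continuous_on[OF DERIV_subset[OF der]]) auto
  have "closed S"
    unfolding S_def using cont by (intro continuous_on_closed_Collect_le continuous_intros) auto
  moreover have "t0 \<in> S" using \<open>t \<ge> t0\<close> by (simp add: S_def M_def)
  moreover have bdd: "bdd_above S" by (auto simp: S_def intro!: bdd_aboveI)
  ultimately have sS: "Sup S \<in> S" by (intro closed_contains_Sup) auto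
  have "\<phi> t \<le> \<phi> (Sup S)"
  proof (rule has_real_derivative_nonpos_imp_le[where \<phi> = \<phi> and \<phi>' = \<phi>'])
    show "Sup S \<le> t" using sS by (simp add: S_def)
    show "(\<phi> has_real_derivative \<phi>' u) (at u within {Sup S..t})" if "Sup S \<le> u" "u \<le> t" for u
      by (rule DERIV_subset[OF der]) (use that sS in \<open>auto simp: S_def\<close>)
    show "\<phi>' u \<le> 0" if "Sup S < u" "u < t" for u
    proof -
      have "u \<notin> S" using cSup_upper[OF _ bdd, of u] that by auto
      then show ?thesis using that sS by (intro barrier) (auto simp: S_def M_def)
    qed
  qed
  with gt sS show False by (simp add: S_def)
qed

lemma set_integrable_domination_continuous:
  fixes g k :: "real \<Rightarrow> real"
  assumes "continuous_on {a..} g" "set_integrable lborel {a..} k"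
    and "\<And>t. t \<ge> a \<Longrightarrow> 0 \<le> g t" "\<And>t. t \<ge> a \<Longrightarrow> g t \<le> C * k t"
  shows "set_integrable lborel {a..} g"
proof (rule set_integrable_bound)
  show "set_integrable lborel {a..} (\<lambda>t. C * k t)"
    using assms(2) by simp
  show "set_borel_measurable lborel {a..} g"
    unfolding set_borel_measurable_def
    using borel_measurable_continuous_on_indicator[OF _ assms(1)] by simp
  show "AE t in lborel. t \<in> {a..} \<longrightarrow> norm (g t) \<le> norm (C * k t)"
    using assms(3,4) by (fastforce intro!: AE_I2)
qed

text \<open>Monotone convergence along the truncations to \<open>{a..a + real n}\<close>: their
  integrals increase and stay below \<open>B\<close>, hence converge.\<close>

lemma set_integrable_atLeast_bounded:
  fixes g :: "real \<Rightarrow> real"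
  assumes cont: "continuous_on {a..} g"
    and nonneg: "\<And>t. t \<ge> a \<Longrightarrow> 0 \<le> g t"
    and bound: "\<And>T. T \<ge> a \<Longrightarrow> integral {a..T} g \<le> B"
  shows "set_integrable lborel {a..} g"
proof -
  define h where "h n t = indicator {a..a + real n} t *\<^sub>R g t" for n :: nat and t
  have int: "set_integrable lborel {a..a + real n} g" for n
    by (rule borel_integrable_atLeastAtMost') (auto intro: continuous_on_subset[OF cont])
  then have inth: "integrable lborel (h n)" for n
    by (simp add: h_def[abs_def] set_integrable_def)
  have mono: "h m t \<le> h n t" if "m \<le> n" for m n t
    using nonneg[of t] that by (auto simp: h_def indicator_def)
  have val: "integral\<^sup>L lborel (h n) = integral {a..a + real n} g" for n
    using set_borel_integral_eq_integral(2)[OF int]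
    by (simp add: h_def[abs_def] set_lebesgue_integral_def)
  have "incseq (\<lambda>n. integral\<^sup>L lborel (h n))"
    by (intro incseq_SucI integral_mono inth mono) auto
  moreover have "integral\<^sup>L lborel (h n) \<le> B" for n
    using bound[of "a + real n"] by (simp add: val)
  ultimately obtain c where c: "(\<lambda>n. integral\<^sup>L lborel (h n)) \<longlonglongrightarrow> c"
    using incseq_convergent by blast
  show ?thesis
    unfolding set_integrable_def
  proof (rule integrable_monotone_convergence[OF inth _ _ c])
    show "AE t in lborel. mono (\<lambda>n. h n t)"
      by (intro AE_I2 monoI mono)
    show "AE t in lborel. (\<lambda>n. h n t) \<longlonglongrightarrow> indicat_real {a..} t *\<^sub>R g t"
    proof (intro AE_I2 tendsto_eventually)
      fix t :: real
      obtain N :: nat where "t - a \<le> real N" using real_arch_simple by blast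
      then show "\<forall>\<^sub>F n in sequentially. h n t = indicat_real {a..} t *\<^sub>R g t"
        by (intro eventually_sequentiallyI[of N]) (auto simp: h_def indicator_def)
    qed
    show "(\<lambda>t. indicat_real {a..} t *\<^sub>R g t) \<in> borel_measurable lborel"
      using borel_measurable_continuous_on_indicator[OF _ cont] by simp
  qed
qed

lemma set_lebesgue_integral_mono_set_nonneg:
  fixes k :: "real \<Rightarrow> real"
  assumes "set_integrable lborel {a..} k" "\<And>t. t \<ge> a \<Longrightarrow> 0 \<le> k t"
  shows "k integrable_on {a..T}" "integral {a..T} k \<le> (LINT t:{a..}|lborel. k t)"
proof -
  have int: "set_integrable lborel {a..T} k"
    by (rule set_integrable_subset[OF assms(1)]) auto
  then show "k integrable_on {a..T}"
    using set_borel_integral_eq_integral(1) by blast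
  have "integral {a..T} k = (LINT t:{a..T}|lborel. k t)"
    using set_borel_integral_eq_integral(2)[OF int] by simp
  also have "\<dots> \<le> (LINT t:{a..}|lborel. k t)"
    using int assms unfolding set_integrable_def set_lebesgue_integral_def
    by (intro integral_mono) (auto simp: indicator_def)
  finally show "integral {a..T} k \<le> (LINT t:{a..}|lborel. k t)" .
qed

text \<open>The differential inequality is integrated over \<open>{a..T}\<close>. The fundamental
  theorem for the gauge integral asks only for differentiability of \<open>E\<close>, so
  \<open>E'\<close> requires no separate integrability proof.\<close>

lemma dissipation_integral_bound:
  fixes E E' g k :: "real \<Rightarrow> real"
  assumes der: "\<And>t. t \<ge> a \<Longrightarrow> (E has_real_derivative E' t) (at t within {a..})"
    and ineq: "\<And>t. t \<ge> a \<Longrightarrow> E' t \<le> k t - g t"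
    and cont: "continuous_on {a..} g"
    and k: "set_integrable lborel {a..} k" "\<And>t. t \<ge> a \<Longrightarrow> 0 \<le> k t"
    and "T \<ge> a"
  shows "E T + integral {a..T} g \<le> E a + (LINT t:{a..}|lborel. k t)"
proof -
  have 1: "(E' has_integral (E T - E a)) {a..T}"
  proof (rule fundamental_theorem_of_calculus[OF \<open>T \<ge> a\<close>])
    show "(E has_vector_derivative E' t) (at t within {a..T})" if "t \<in> {a..T}" for t
      using DERIV_subset[OF der[of t], of "{a..T}"] that
      by (auto simp: has_real_derivative_iff_has_vector_derivative)
  qed
  have g: "g integrable_on {a..T}"
    using cont by (intro integrable_continuous_real) (auto intro: continuous_on_subset)
  have "((\<lambda>t. k t - g t) has_integral (integral {a..T} k - integral {a..T} g)) {a..T}"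
    using g set_lebesgue_integral_mono_set_nonneg(1)[OF k]
    by (intro has_integral_diff) (auto simp: integrable_integral)
  with 1 have "E T - E a \<le> integral {a..T} k - integral {a..T} g"
    by (rule has_integral_le) (use ineq in auto)
  then show ?thesis
    using set_lebesgue_integral_mono_set_nonneg(2)[OF k, of T] by linarith
qed

text \<open>Nonnegativity of \<open>E\<close> discards the final energy, which leaves a bound on the
  dissipated integral uniform in the end time.\<close>

lemma dissipation_integrable:
  fixes E E' g k :: "real \<Rightarrow> real"
  assumes der: "\<And>t. t \<ge> a \<Longrightarrow> (E has_real_derivative E' t) (at t within {a..})"
    and nonneg: "\<And>t. t \<ge> a \<Longrightarrow> 0 \<le> E t" "\<And>t. t \<ge> a \<Longrightarrow> 0 \<le> g t"
    and ineq: "\<And>t. t \<ge> a \<Longrightarrow> E' t \<le> k t - g t"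
    and cont: "continuous_on {a..} g"
    and k: "set_integrable lborel {a..} k" "\<And>t. t \<ge> a \<Longrightarrow> 0 \<le> k t"
  shows "set_integrable lborel {a..} g"
proof (rule set_integrable_atLeast_bounded[OF cont nonneg(2)])
  show "integral {a..T} g \<le> E a + (LINT t:{a..}|lborel. k t)" if "T \<ge> a" for T
    using dissipation_integral_bound[OF der ineq cont k that] nonneg(1)[OF that] by simp
qed

text \<open>All difference quotients are nonpositive. Taking the limit within the half-line includes
  the one-sided derivative at \<open>a\<close>.\<close>

lemma antimono_on_imp_has_real_derivative_nonpos:
  fixes \<phi> :: "real \<Rightarrow> real"
  assumes "antimono_on {a..} \<phi>" "(\<phi> has_real_derivative D) (at t within {a..})" "t \<ge> a"
  shows "D \<le> 0"
proof (rule tendsto_upperbound)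
  show "((\<lambda>s. (\<phi> s - \<phi> t) / (s - t)) \<longlongrightarrow> D) (at t within {a..})"
    using assms(2) by (simp add: has_field_derivative_iff)
  have "(\<phi> s - \<phi> t) / (s - t) \<le> 0" if "s \<ge> a" for s
    using monotone_onD[OF assms(1), of s t] monotone_onD[OF assms(1), of t s] that assms(3)
    by (cases "s \<le> t") (auto simp: divide_le_0_iff)
  then show "\<forall>\<^sub>F s in at t within {a..}. (\<phi> s - \<phi> t) / (s - t) \<le> 0"
    by (auto simp: eventually_at_filter)
  \<comment> \<open>Passing to the limit requires a nontrivial filter; right neighbourhoods of
    \<open>t\<close> provide it, also when \<open>t = a\<close>.\<close>
  have "at_right t \<le> at t within {a..}"
    using assms(3) by (intro at_le) auto
  then show "at t within {a..} \<noteq> bot"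
    using trivial_limit_at_right_real[of t] by (metis bot.extremum_unique)
qed

section \<open>Riesz representation and the adjoint\<close>

text \<open>The representing vector minimises \<open>\<parallel>u\<parallel>\<^sup>2 / 2 - \<phi> u\<close>; by the parallelogram law minimising
  sequences are Cauchy.\<close>

lemma riesz_representation:
  fixes \<phi> :: "'a::{real_inner, complete_space} \<Rightarrow> real"
  assumes "bounded_linear \<phi>"
  obtains u where "\<And>v. \<phi> v = u \<bullet> v"
proof -
  interpret bounded_linear \<phi> by fact
  define J where "J u = (norm u)\<^sup>2 / 2 - \<phi> u" for u
  define m where "m = Inf (range J)"
  obtain K where K: "\<And>u. norm (\<phi> u) \<le> norm u * K" using bounded by blast
  have "- K\<^sup>2 / 2 \<le> J u" for u
  proof -
    have "0 \<le> (norm u - K)\<^sup>2" by simp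
    then have "norm u * K \<le> (norm u)\<^sup>2 / 2 + K\<^sup>2 / 2"
      by (simp add: power2_diff)
    then show ?thesis using K[of u] by (simp add: J_def)
  qed
  then have "bdd_below (range J)" by (auto intro!: bdd_belowI)
  then have m_le: "m \<le> J u" for u by (auto simp: m_def intro: cInf_lower)
  have "\<exists>u. J u < m + 1 / Suc n" for n
    using cInf_lessD[of "range J" "m + 1 / Suc n"] by (auto simp: m_def)
  then obtain s where s: "\<And>n. J (s n) < m + 1 / Suc n" by metis
  \<comment> \<open>The parallelogram law, with \<open>m\<close> as lower bound for the value of
    \<open>J\<close> at the midpoint.\<close>
  have par: "(norm (u - v))\<^sup>2 / 4 \<le> J u + J v - 2 * m" for u v
  proof -
    have "J u + J v - 2 * J ((1/2) *\<^sub>R (u + v)) = (norm (u - v))\<^sup>2 / 4"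
      unfolding J_def scaleR add power2_norm_eq_inner
      by (simp add: inner_add inner_diff inner_commute field_simps)
    then show ?thesis using m_le[of "(1/2) *\<^sub>R (u + v)"] by linarith
  qed
  have "Cauchy s"
  proof (rule metric_CauchyI)
    fix e :: real
    assume "e > 0"
    \<comment> \<open>Two excesses over \<open>m\<close> below \<open>e\<^sup>2 / 8\<close> add up
      to \<open>e\<^sup>2 / 4\<close>, which matches the factor 1/4 in \<open>par\<close>.\<close>
    then obtain N where N: "1 / Suc N < e\<^sup>2 / 8"
      using reals_Archimedean[of "e\<^sup>2 / 8"] by (auto simp: inverse_eq_divide)
    show "\<exists>M. \<forall>i\<ge>M. \<forall>j\<ge>M. dist (s i) (s j) < e"
    proof (intro exI allI impI)
      fix i j assume "i \<ge> N" "j \<ge> N"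
      then have "1 / Suc i \<le> 1 / Suc N" "1 / Suc j \<le> 1 / Suc N" by (auto simp: field_simps)
      then have "(norm (s i - s j))\<^sup>2 < e\<^sup>2"
        using par[of "s i" "s j"] s[of i] s[of j] N by linarith
      then show "dist (s i) (s j) < e"
        using \<open>e > 0\<close> by (simp add: dist_norm power2_less_imp_less)
    qed
  qed
  then obtain u where u: "s \<longlonglongrightarrow> u" using convergentD Cauchy_convergent by blast
  have "(\<lambda>n. J (s n)) \<longlonglongrightarrow> J u"
    unfolding J_def by (intro tendsto_intros tendsto u) simp
  moreover have "(\<lambda>n. m + 1 / Suc n) \<longlonglongrightarrow> m + 0"
    by (intro tendsto_intros LIMSEQ_Suc[OF lim_1_over_n])
  moreover have "\<exists>N. \<forall>n\<ge>N. J (s n) \<le> m + 1 / Suc n" using s less_imp_le by blast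
  ultimately have "J u \<le> m + 0" by (rule LIMSEQ_le)
  then have "J u \<le> m" by simp
  have min: "J u \<le> J w" for w using \<open>J u \<le> m\<close> m_le[of w] by linarith
  have "\<phi> v = u \<bullet> v" for v
  proof -
    \<comment> \<open>The increment of \<open>J\<close> from the minimiser \<open>u\<close> along
      \<open>v\<close>; its linear coefficient has to vanish.\<close>
    let ?q = "\<lambda>r. r * (u \<bullet> v - \<phi> v) + r\<^sup>2 * (v \<bullet> v) / 2"
    have eq: "J (u + r *\<^sub>R v) - J u = ?q r" for r
      unfolding J_def scaleR add power2_norm_eq_inner
      by (simp add: inner_add inner_commute field_simps power2_eq_square)
    have "DERIV ?q 0 :> u \<bullet> v - \<phi> v" by (auto intro!: derivative_eq_intros)
    then have "u \<bullet> v - \<phi> v = 0"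
      by (rule DERIV_local_min[of _ _ _ 1]) (use min eq[symmetric] in \<open>auto simp del: mult_eq_0_iff\<close>)
    then show ?thesis by simp
  qed
  then show thesis by (rule that)
qed

text \<open>Riesz representation of \<open>\<lambda>u. A u \<bullet> v\<close> for each
  \<open>v\<close> exhibits one operator with this identity, so the choice operator behind
  \<open>adjoint\<close> selects such an operator.\<close>

lemma adjoint_bounded_linear:
  fixes A :: "'a::{real_inner, complete_space} \<Rightarrow> 'b::real_inner"
  assumes "bounded_linear A"
  shows "u \<bullet> adjoint A v = A u \<bullet> v"
proof -
  have "\<exists>w. \<forall>u. A u \<bullet> v = u \<bullet> w" for v
  proof -
    have "bounded_linear (\<lambda>u. A u \<bullet> v)"
      by (rule bounded_linear_compose[OF bounded_linear_inner_left assms])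
    then obtain w where "\<And>u. A u \<bullet> v = w \<bullet> u"
      using riesz_representation by blast
    then show ?thesis by (auto simp: inner_commute)
  qed
  then have "\<exists>B. \<forall>u v. A u \<bullet> v = u \<bullet> B v" by metis
  then show ?thesis unfolding adjoint_def by (rule someI2_ex) auto
qed

section \<open>Gradient inequalities for convex and smooth functions\<close>

lemma GDERIV_along_line:
  fixes f :: "'a::real_inner \<Rightarrow> real"
  assumes "\<And>u. GDERIV f u :> gradf u"
  shows "((\<lambda>s. f (u + s *\<^sub>R v)) has_real_derivative gradf (u + s *\<^sub>R v) \<bullet> v) (at s)"
proof -
  have "((\<lambda>s. u + s *\<^sub>R v) has_derivative (\<lambda>r. r *\<^sub>R v)) (at s)"
    by (auto intro!: derivative_eq_intros)
  then have "((\<lambda>s. f (u + s *\<^sub>R v)) has_derivative (\<lambda>r. (r *\<^sub>R v) \<bullet> gradf (u + s *\<^sub>R v))) (at s)"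
    by (rule has_derivative_compose) (use assms in \<open>simp add: gderiv_def\<close>)
  moreover have "(\<lambda>r. (r *\<^sub>R v) \<bullet> gradf (u + s *\<^sub>R v)) = (*) (gradf (u + s *\<^sub>R v) \<bullet> v)"
    by (simp add: fun_eq_iff inner_commute)
  ultimately show ?thesis by (simp add: has_field_derivative_def)
qed

text \<open>Restricting \<open>f\<close> to the line through \<open>u\<close> and \<open>v\<close>
  reduces this to the tangent inequality in one variable.\<close>

lemma convex_on_imp_above_tangent_GDERIV:
  fixes f :: "'a::real_inner \<Rightarrow> real"
  assumes "convex_on UNIV f" "\<And>u. GDERIV f u :> gradf u"
  shows "f u + gradf u \<bullet> (v - u) \<le> f v"
proof -
  let ?\<phi> = "\<lambda>s. f (u + s *\<^sub>R (v - u))"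
  have "convex_on UNIV ?\<phi>"
  proof (intro convex_onI)
    fix r p q :: real assume "0 < r" "r < 1"
    moreover have "u + ((1 - r) *\<^sub>R p + r *\<^sub>R q) *\<^sub>R (v - u)
        = (1 - r) *\<^sub>R (u + p *\<^sub>R (v - u)) + r *\<^sub>R (u + q *\<^sub>R (v - u))"
      by (simp add: algebra_simps)
    ultimately show "?\<phi> ((1 - r) *\<^sub>R p + r *\<^sub>R q) \<le> (1 - r) * ?\<phi> p + r * ?\<phi> q"
      using convex_onD[OF assms(1), of r] by simp
  qed auto
  from convex_on_imp_above_tangent[OF this _ _ _ GDERIV_along_line[OF assms(2)], of 0 1]
  show ?thesis by simp
qed

text \<open>Here \<open>?\<phi>\<close> is \<open>f\<close> along the segment minus its quadratic
  model, up to a constant; Cauchy-Schwarz and the Lipschitz bound make its derivative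
  nonpositive.\<close>

lemma lipschitz_gradient_descent:
  fixes f :: "'a::real_inner \<Rightarrow> real"
  assumes "\<And>u. GDERIV f u :> gradf u" "L-lipschitz_on UNIV gradf"
  shows "f (u + v) \<le> f u + gradf u \<bullet> v + L / 2 * (norm v)\<^sup>2"
proof -
  let ?\<phi> = "\<lambda>s. f (u + s *\<^sub>R v) - s * (gradf u \<bullet> v) - L * s\<^sup>2 / 2 * (norm v)\<^sup>2"
  let ?\<phi>' = "\<lambda>s. (gradf (u + s *\<^sub>R v) - gradf u) \<bullet> v - L * s * (norm v)\<^sup>2"
  have "?\<phi> 1 \<le> ?\<phi> 0"
  proof (rule has_real_derivative_nonpos_imp_le[where \<phi> = ?\<phi> and \<phi>' = ?\<phi>'])
    show "(?\<phi> has_real_derivative ?\<phi>' s) (at s within {0..1})" for s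
      by (rule has_field_derivative_at_within)
        (auto intro!: derivative_eq_intros GDERIV_along_line[OF assms(1)] simp: inner_diff)
    show "?\<phi>' s \<le> 0" if "0 < s" for s
    proof -
      have "norm (gradf (u + s *\<^sub>R v) - gradf u) \<le> L * (s * norm v)"
        using lipschitz_onD[OF assms(2), of "u + s *\<^sub>R v" u] that by (simp add: dist_norm)
      then have "norm (gradf (u + s *\<^sub>R v) - gradf u) * norm v \<le> L * (s * norm v) * norm v"
        by (intro mult_right_mono) auto
      then show ?thesis
        using norm_cauchy_schwarz[of "gradf (u + s *\<^sub>R v) - gradf u" v]
        by (simp add: power2_eq_square mult.assoc)
    qed
  qed simp
  then show ?thesis by simp
qed

text \<open>Once its linear part at \<open>u\<close> is removed, \<open>f\<close> is minimal at \<open>u\<close>; compare with the value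
  after a gradient step of length \<open>1 / L\<close> from \<open>v\<close>.\<close>

lemma convex_lipschitz_gradient_lower_bound:
  fixes f :: "'a::real_inner \<Rightarrow> real"
  assumes "convex_on UNIV f" "\<And>u. GDERIV f u :> gradf u" "L-lipschitz_on UNIV gradf" "L > 0"
  shows "(norm (gradf v - gradf u))\<^sup>2 \<le> 2 * L * (f v - f u - gradf u \<bullet> (v - u))"
proof -
  define d where "d = gradf v - gradf u"
  \<comment> \<open>The end point of the gradient step is estimated from below by the tangent at
    \<open>u\<close> and from above by the descent inequality at \<open>v\<close>.\<close>
  have "f u + gradf u \<bullet> (v - (1 / L) *\<^sub>R d - u) \<le> f (v + (- (1 / L)) *\<^sub>R d)"
    using convex_on_imp_above_tangent_GDERIV[OF assms(1,2), of u "v - (1 / L) *\<^sub>R d"] by simp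
  also have "\<dots> \<le> f v + gradf v \<bullet> ((- (1 / L)) *\<^sub>R d) + L / 2 * (norm ((- (1 / L)) *\<^sub>R d))\<^sup>2"
    by (rule lipschitz_gradient_descent[OF assms(2,3)])
  also have "L / 2 * (norm ((- (1 / L)) *\<^sub>R d))\<^sup>2 = (norm d)\<^sup>2 / (2 * L)"
    using \<open>L > 0\<close> by (simp add: power_mult_distrib power2_eq_square)
  finally have "(d \<bullet> d) / L \<le> f v - f u - gradf u \<bullet> (v - u) + (norm d)\<^sup>2 / (2 * L)"
    by (simp add: d_def inner_diff diff_divide_distrib)
  then show ?thesis
    using \<open>L > 0\<close> by (simp add: d_def[symmetric] power2_norm_eq_inner[symmetric] field_simps)
qed

section \<open>Barriers for norms and order estimates\<close>

lemma norm_sq_deriv: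
  assumes "(u has_vector_derivative u') (at t within S)"
  shows "((\<lambda>t. (norm (u t))\<^sup>2) has_real_derivative 2 * (u t \<bullet> u')) (at t within S)"
proof -
  have "((\<lambda>t. u t \<bullet> u t) has_vector_derivative u t \<bullet> u' + u' \<bullet> u t) (at t within S)"
    by (rule bounded_bilinear.has_vector_derivative[OF bounded_bilinear_inner assms assms])
  then show ?thesis
    by (simp add: has_real_derivative_iff_has_vector_derivative power2_norm_eq_inner inner_commute)
qed

text \<open>Once \<open>\<parallel>u\<parallel>\<close> exceeds the bound \<open>C\<close>, the velocity points inwards.\<close>

lemma bounded_from_extrapolation:
  fixes u u' :: "real \<Rightarrow> 'a::real_inner"
  assumes der: "\<And>t. t \<ge> t0 \<Longrightarrow> (u has_vector_derivative u' t) (at t within {t0..})"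
    and bound: "\<And>t. t \<ge> t0 \<Longrightarrow> norm (u t + (\<theta> * t) *\<^sub>R u' t) \<le> C"
    and "\<theta> > 0" "t0 > 0" "t \<ge> t0"
  shows "norm (u t) \<le> max C (norm (u t0))"
proof -
  have "(norm (u t))\<^sup>2 \<le> max (C\<^sup>2) ((norm (u t0))\<^sup>2)"
  proof (rule barrier_bound[OF norm_sq_deriv[OF der] _ \<open>t \<ge> t0\<close>])
    fix s assume s: "s \<ge> t0" and ge: "(norm (u s))\<^sup>2 \<ge> C\<^sup>2"
    have "C \<le> norm (u s)" by (rule power2_le_imp_le[OF ge]) simp
    then have "norm (u s) * norm (u s + (\<theta> * s) *\<^sub>R u' s) \<le> norm (u s) * norm (u s)"
      using bound[OF s] by (intro mult_left_mono) auto
    then have "u s \<bullet> (u s + (\<theta> * s) *\<^sub>R u' s) \<le> u s \<bullet> u s"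
      using norm_cauchy_schwarz[of "u s" "u s + (\<theta> * s) *\<^sub>R u' s"]
      by (simp add: power2_norm_eq_inner[symmetric] power2_eq_square)
    then have "\<theta> * s * (u s \<bullet> u' s) \<le> 0" by (simp add: inner_add_right)
    moreover have "\<theta> * s > 0" using s assms(3,4) by simp
    ultimately have "u s \<bullet> u' s \<le> 0" by (meson mult_pos_pos not_le)
    then show "2 * (u s \<bullet> u' s) \<le> 0" by simp
  qed
  also have "\<dots> \<le> (max C (norm (u t0)))\<^sup>2"
    \<comment> \<open>\<open>C\<close> is nonnegative because it bounds a norm at \<open>t0\<close>;
      squaring therefore preserves \<open>C \<le> max C (norm (u t0))\<close>.\<close>
    using norm_ge_zero[of "u t0 + (\<theta> * t0) *\<^sub>R u' t0"] bound[of t0]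
    by (intro max.boundedI power_mono) (linarith | simp)+
  finally show ?thesis
    by (rule power2_le_imp_le) (simp add: le_max_iff_disj)
qed

lemma bigo_at_top_I:
  fixes \<phi> \<psi> :: "real \<Rightarrow> real"
  assumes "\<And>t. t \<ge> t0 \<Longrightarrow> \<bar>\<phi> t\<bar> \<le> C * \<psi> t" "\<And>t. t \<ge> t0 \<Longrightarrow> 0 \<le> \<psi> t"
  shows "\<phi> \<in> O[at_top](\<psi>)"
  by (rule bigoI[where c = C], rule eventually_at_top_linorderI[of t0]) (use assms in auto)

section \<open>Optimality conditions at a saddle point\<close>

lemma saddle_point_feasible:
  assumes "(xs, ls) \<in> saddle_points (lagrangian f A b)"
  shows "A xs = b"
proof -
  \<comment> \<open>Shifting the multiplier by the residual itself changes the Lagrangian by the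
    squared norm of the residual.\<close>
  have "lagrangian f A b xs (ls + (A xs - b)) \<le> lagrangian f A b xs ls"
    using assms by (simp add: saddle_points_def)
  then have "(A xs - b) \<bullet> (A xs - b) \<le> 0"
    by (simp add: lagrangian_def inner_add_left)
  then show ?thesis by (metis eq_iff_diff_eq_0 inner_eq_zero_iff inner_ge_zero order_antisym)
qed

text \<open>The minimum in the primal variable is tested along \<open>d\<close> itself, so the
  directional derivative that vanishes is \<open>d \<bullet> d\<close>.\<close>

lemma saddle_point_stationary:
  assumes saddle: "(xs, ls) \<in> saddle_points (lagrangian f A b)"
    and A: "bounded_linear A" and adj: "\<And>u v. u \<bullet> B v = A u \<bullet> v"
    and f_grad: "\<And>u. GDERIV f u :> gradf u"
  shows "gradf xs + B ls = 0"
proof -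
  define d where "d = gradf xs + B ls"
  let ?\<phi> = "\<lambda>s. lagrangian f A b (xs + s *\<^sub>R d) ls"
  have "?\<phi> = (\<lambda>s. f (xs + s *\<^sub>R d) + (ls \<bullet> (A xs - b) + s * (ls \<bullet> A d)))"
    using A by (simp add: fun_eq_iff lagrangian_def bounded_linear.linear linear_add linear_scale
        inner_add inner_diff)
  moreover have "((\<lambda>s. f (xs + s *\<^sub>R d) + (ls \<bullet> (A xs - b) + s * (ls \<bullet> A d))) has_real_derivative
      gradf (xs + 0 *\<^sub>R d) \<bullet> d + (0 + 1 * (ls \<bullet> A d))) (at 0)"
    by (intro derivative_intros GDERIV_along_line[OF f_grad] DERIV_cmult_right)
  ultimately have "DERIV ?\<phi> 0 :> d \<bullet> d"
    using adj[of d ls] by (simp add: d_def inner_add inner_commute)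
  then have "d \<bullet> d = 0"
    by (rule DERIV_local_min[of _ _ _ 1]) (use saddle in \<open>auto simp: saddle_points_def\<close>)
  then show ?thesis by (simp add: d_def)
qed

section \<open>The trajectory, its energy and the energy derivative\<close>

text \<open>The hypotheses in working form: the adjoint enters as an operator \<open>B\<close> with
  its defining identity, monotonicity of \<open>\<epsilon>\<close> as the sign of
  \<open>\<epsilon>'\<close>, the growth condition multiplied by \<open>\<theta>\<close>, and the
  saddle property as feasibility and stationarity.\<close>

locale primal_dual_trajectory =
  fixes f :: "'a::real_inner \<Rightarrow> real"
    and gradf :: "'a \<Rightarrow> 'a"
    and A :: "'a \<Rightarrow> 'b::real_inner"
    and B :: "'b \<Rightarrow> 'a"
    and b :: 'b
    and L t0 \<alpha> \<theta> \<rho> :: real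
    and \<beta> \<beta>' \<epsilon> \<epsilon>' :: "real \<Rightarrow> real"
    and x x' x'' :: "real \<Rightarrow> 'a" and l l' l'' :: "real \<Rightarrow> 'b"
    and xs :: 'a and ls :: 'b
  assumes A: "bounded_linear A"
    and adj: "u \<bullet> B v = A u \<bullet> v"
    and f_convex: "convex_on UNIV f"
    and f_grad: "GDERIV f u :> gradf u"
    and L_pos: "L > 0"
    and gradf_lipschitz: "L-lipschitz_on UNIV gradf"
    and t0_pos: "t0 > 0"
    and eps_nonneg: "t \<ge> t0 \<Longrightarrow> \<epsilon> t \<ge> 0"
    and eps_deriv: "t \<ge> t0 \<Longrightarrow> (\<epsilon> has_real_derivative \<epsilon>' t) (at t within {t0..})"
    and eps_deriv_nonpos: "t \<ge> t0 \<Longrightarrow> \<epsilon>' t \<le> 0"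
    and beta_pos: "t \<ge> t0 \<Longrightarrow> \<beta> t > 0"
    and beta_deriv: "t \<ge> t0 \<Longrightarrow> (\<beta> has_real_derivative \<beta>' t) (at t within {t0..})"
    and alpha: "\<alpha> > 1"
    and theta: "\<theta> \<ge> 1 / (\<alpha> - 1)"
    and rho: "\<rho> \<ge> 0"
    and beta_growth: "t \<ge> t0 \<Longrightarrow> \<theta> * (t * \<beta>' t) \<le> (1 - 2 * \<theta>) * \<beta> t"
    and eps_integrable: "set_integrable lborel {t0..} (\<lambda>t. t * \<beta> t * \<epsilon> t)"
    and x_deriv: "t \<ge> t0 \<Longrightarrow> (x has_vector_derivative x' t) (at t within {t0..})"
    and x'_deriv: "t \<ge> t0 \<Longrightarrow> (x' has_vector_derivative x'' t) (at t within {t0..})"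
    and l_deriv: "t \<ge> t0 \<Longrightarrow> (l has_vector_derivative l' t) (at t within {t0..})"
    and l'_deriv: "t \<ge> t0 \<Longrightarrow> (l' has_vector_derivative l'' t) (at t within {t0..})"
    and x_ode: "t \<ge> t0 \<Longrightarrow> x'' t + (\<alpha> / t) *\<^sub>R x' t =
             - (\<beta> t *\<^sub>R (gradf (x t) + B (l t + (\<theta> * t) *\<^sub>R l' t)
                        + \<rho> *\<^sub>R B (A (x t) - b) + \<epsilon> t *\<^sub>R x t))"
    and l_ode: "t \<ge> t0 \<Longrightarrow> l'' t + (\<alpha> / t) *\<^sub>R l' t = \<beta> t *\<^sub>R (A (x t + (\<theta> * t) *\<^sub>R x' t) - b)"
    and feasible: "A xs = b"
    and stationary: "gradf xs + B ls = 0"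
begin

lemma theta_pos: "\<theta> > 0"
  using alpha theta by (smt (verit) divide_pos_pos)

text \<open>The damping left in \<open>w'\<close> and \<open>v'\<close> once the system is
  substituted, as \<open>1 + \<theta> - \<theta> * \<alpha> = - gap_weight\<close>. Using the same
  weight in the energy cancels the products \<open>z t \<bullet> x' t\<close> and
  \<open>y t \<bullet> l' t\<close>.\<close>

definition gap_weight :: real where "gap_weight = (\<alpha> - 1) * \<theta> - 1"

lemma gap_weight_nonneg: "gap_weight \<ge> 0"
  using alpha theta by (simp add: gap_weight_def field_simps)

definition z where "z t = x t - xs"
definition y where "y t = l t - ls"
definition w where "w t = z t + (\<theta> * t) *\<^sub>R x' t"
definition v where "v t = y t + (\<theta> * t) *\<^sub>R l' t"

definition gap where
  "gap t = f (x t) - f xs + ls \<bullet> A (z t) + \<rho> / 2 * (norm (A (z t)))\<^sup>2"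

definition energy where
  "energy t = \<theta>\<^sup>2 * t\<^sup>2 * \<beta> t * (gap t + \<epsilon> t / 2 * (norm (x t))\<^sup>2)
     + (norm (w t))\<^sup>2 / 2 + (norm (v t))\<^sup>2 / 2
     + gap_weight / 2 * ((norm (z t))\<^sup>2 + (norm (y t))\<^sup>2)"

definition gap' where
  "gap' t = gradf (x t) \<bullet> x' t + ls \<bullet> A (x' t) + \<rho> * (A (z t) \<bullet> A (x' t))"

definition w' where "w' t = (1 + \<theta>) *\<^sub>R x' t + (\<theta> * t) *\<^sub>R x'' t"
definition v' where "v' t = (1 + \<theta>) *\<^sub>R l' t + (\<theta> * t) *\<^sub>R l'' t"

definition energy' where
  "energy' t = \<theta>\<^sup>2 * (2 * t * \<beta> t + t\<^sup>2 * \<beta>' t) * (gap t + \<epsilon> t / 2 * (norm (x t))\<^sup>2)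
     + \<theta>\<^sup>2 * t\<^sup>2 * \<beta> t * (gap' t + \<epsilon>' t / 2 * (norm (x t))\<^sup>2 + \<epsilon> t * (x t \<bullet> x' t))
     + w t \<bullet> w' t + v t \<bullet> v' t + gap_weight * (z t \<bullet> x' t + y t \<bullet> l' t)"

lemma residual: "A (x t) - b = A (z t)"
  using feasible by (simp add: z_def bounded_linear.linear[OF A] linear_diff)

text \<open>Stationarity turns the linear term of \<open>f\<close> at \<open>xs\<close> into the
  multiplier term, so the Lagrangian gap is the Bregman distance of \<open>f\<close> from
  \<open>xs\<close> to \<open>x t\<close>.\<close>

lemma lagrangian_gap: "gradf xs \<bullet> z t = - (ls \<bullet> A (z t))"
proof -
  have "gradf xs = - B ls" using stationary by (simp add: eq_neg_iff_add_eq_0)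
  then show ?thesis using adj[of "z t" ls] by (simp add: inner_commute)
qed

text \<open>The cocoercivity bound for that Bregman distance. It yields both the sign of the gap and
  the gradient estimates.\<close>

lemma cocoercive_gap:
  "(norm (gradf (x t) - gradf xs))\<^sup>2 \<le> 2 * L * (f (x t) - f xs + ls \<bullet> A (z t))"
  using convex_lipschitz_gradient_lower_bound[OF f_convex f_grad gradf_lipschitz L_pos, of "x t" xs]
    lagrangian_gap[of t]
  by (simp add: z_def)

lemma lagrangian_gap_nonneg: "0 \<le> f (x t) - f xs + ls \<bullet> A (z t)"
  using order_trans[OF zero_le_power2 cocoercive_gap[of t]] L_pos by (simp add: zero_le_mult_iff)

lemma gap_ge: "f (x t) - f xs + ls \<bullet> A (z t) \<le> gap t"
  using rho by (simp add: gap_def)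

lemma gap_nonneg: "0 \<le> gap t"
  using gap_ge[of t] lagrangian_gap_nonneg[of t] by linarith

text \<open>All summands of the energy are nonnegative, so each is bounded by the whole.\<close>

lemma energy_ge:
  assumes "t \<ge> t0"
  shows "\<theta>\<^sup>2 * (t\<^sup>2 * \<beta> t * gap t) \<le> energy t"
    and "(norm (w t))\<^sup>2 \<le> 2 * energy t" "(norm (v t))\<^sup>2 \<le> 2 * energy t"
proof -
  define p q r where "p = \<theta>\<^sup>2 * (t\<^sup>2 * \<beta> t * gap t)"
    and "q = \<theta>\<^sup>2 * (t\<^sup>2 * \<beta> t * (\<epsilon> t / 2 * (norm (x t))\<^sup>2))"
    and "r = gap_weight / 2 * ((norm (z t))\<^sup>2 + (norm (y t))\<^sup>2)"
  have "energy t = p + q + (norm (w t))\<^sup>2 / 2 + (norm (v t))\<^sup>2 / 2 + r"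
    by (simp add: energy_def p_def q_def r_def algebra_simps)
  moreover have "0 \<le> p" "0 \<le> q" "0 \<le> r"
    using beta_pos[OF assms] eps_nonneg[OF assms] gap_nonneg[of t] gap_weight_nonneg
    by (simp_all add: p_def q_def r_def)
  moreover have "0 \<le> (norm (w t))\<^sup>2" "0 \<le> (norm (v t))\<^sup>2" by auto
  ultimately have "p \<le> energy t \<and> (norm (w t))\<^sup>2 \<le> 2 * energy t \<and> (norm (v t))\<^sup>2 \<le> 2 * energy t"
    by linarith
  then show "\<theta>\<^sup>2 * (t\<^sup>2 * \<beta> t * gap t) \<le> energy t"
    "(norm (w t))\<^sup>2 \<le> 2 * energy t" "(norm (v t))\<^sup>2 \<le> 2 * energy t"
    by (simp_all add: p_def)
qed

lemma energy_nonneg: "t \<ge> t0 \<Longrightarrow> 0 \<le> energy t"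
  using energy_ge(2)[of t] by (smt (verit) zero_le_power2)

context
  fixes t assumes t: "t \<ge> t0"
begin

lemma t_pos: "t > 0" using t t0_pos by simp

lemma z_deriv: "(z has_vector_derivative x' t) (at t within {t0..})"
  unfolding z_def[abs_def] by (auto intro!: derivative_eq_intros x_deriv t)

lemma y_deriv: "(y has_vector_derivative l' t) (at t within {t0..})"
  unfolding y_def[abs_def] by (auto intro!: derivative_eq_intros l_deriv t)

lemma Az_deriv: "((\<lambda>t. A (z t)) has_vector_derivative A (x' t)) (at t within {t0..})"
  by (rule bounded_linear.has_vector_derivative[OF A z_deriv])

lemma w_deriv: "(w has_vector_derivative w' t) (at t within {t0..})"
  unfolding w_def[abs_def] w'_def
  by (rule has_vector_derivative_eq_rhs, (rule derivative_intros z_deriv x'_deriv t)+)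
    (auto simp: algebra_simps)

lemma v_deriv: "(v has_vector_derivative v' t) (at t within {t0..})"
  unfolding v_def[abs_def] v'_def
  by (rule has_vector_derivative_eq_rhs, (rule derivative_intros y_deriv l'_deriv t)+)
    (auto simp: algebra_simps)

lemma f_x_deriv: "((\<lambda>t. f (x t)) has_real_derivative gradf (x t) \<bullet> x' t) (at t within {t0..})"
proof -
  have "((\<lambda>t. f (x t)) has_derivative (\<lambda>r. (r *\<^sub>R x' t) \<bullet> gradf (x t))) (at t within {t0..})"
    using x_deriv[OF t] f_grad[of "x t"]
    unfolding has_vector_derivative_def gderiv_def by (rule has_derivative_compose)
  moreover have "(\<lambda>r. (r *\<^sub>R x' t) \<bullet> gradf (x t)) = (*) (gradf (x t) \<bullet> x' t)"
    by (simp add: fun_eq_iff inner_commute)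
  ultimately show ?thesis by (simp add: has_field_derivative_def)
qed

lemma gap_deriv: "(gap has_real_derivative gap' t) (at t within {t0..})"
proof -
  have "((\<lambda>t. ls \<bullet> A (z t)) has_real_derivative ls \<bullet> A (x' t)) (at t within {t0..})"
    unfolding has_real_derivative_iff_has_vector_derivative
    by (rule bounded_linear.has_vector_derivative[OF bounded_linear_inner_right Az_deriv])
  then show ?thesis
    unfolding gap_def[abs_def] gap'_def
    by - (rule DERIV_cong, (rule f_x_deriv norm_sq_deriv[OF Az_deriv] derivative_intros | assumption)+, simp)
qed

lemma energy_deriv: "(energy has_real_derivative energy' t) (at t within {t0..})"
proof -
  have 1: "((\<lambda>t. \<theta>\<^sup>2 * t\<^sup>2 * \<beta> t) has_real_derivative \<theta>\<^sup>2 * (2 * t * \<beta> t + t\<^sup>2 * \<beta>' t)) (at t within {t0..})"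
    by (auto intro!: derivative_eq_intros beta_deriv t simp: algebra_simps)
  have 2: "((\<lambda>t. gap t + \<epsilon> t / 2 * (norm (x t))\<^sup>2) has_real_derivative
      gap' t + \<epsilon>' t / 2 * (norm (x t))\<^sup>2 + \<epsilon> t * (x t \<bullet> x' t)) (at t within {t0..})"
    by (rule DERIV_cong[OF DERIV_add[OF gap_deriv
          DERIV_mult[OF DERIV_cdivide[OF eps_deriv[OF t]] norm_sq_deriv[OF x_deriv[OF t]]]]]) simp
  show ?thesis
    unfolding energy_def[abs_def]
    by (rule DERIV_cong[OF DERIV_add[OF DERIV_add[OF DERIV_add[OF DERIV_mult[OF 1 2]
            DERIV_cdivide[OF norm_sq_deriv[OF w_deriv]]] DERIV_cdivide[OF norm_sq_deriv[OF v_deriv]]]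
          DERIV_cmult[OF DERIV_add[OF norm_sq_deriv[OF z_deriv] norm_sq_deriv[OF y_deriv]]]]])
      (simp add: energy'_def algebra_simps)
qed

text \<open>The extrapolated multiplier in the system is \<open>ls + v t\<close>, and the factor
  \<open>\<theta> * t\<close> absorbs the \<open>1 / t\<close> of the damping.\<close>

lemma w'_eq: "w' t = - gap_weight *\<^sub>R x' t - (\<theta> * t * \<beta> t) *\<^sub>R
    (gradf (x t) + B (ls + v t) + \<rho> *\<^sub>R B (A (z t)) + \<epsilon> t *\<^sub>R x t)"
proof -
  define G where "G = gradf (x t) + B (ls + v t) + \<rho> *\<^sub>R B (A (z t)) + \<epsilon> t *\<^sub>R x t"
  have "x'' t = - (\<beta> t *\<^sub>R G) - (\<alpha> / t) *\<^sub>R x' t"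
    using x_ode[OF t] by (simp add: G_def residual v_def y_def eq_diff_eq)
  then have eq: "(\<theta> * t) *\<^sub>R x'' t = - (\<theta> * t * \<beta> t) *\<^sub>R G - (\<theta> * \<alpha>) *\<^sub>R x' t"
    using t_pos by (simp add: scaleR_diff_right)
  then show ?thesis
    unfolding w'_def G_def[symmetric] eq by (simp add: gap_weight_def algebra_simps)
qed

lemma v'_eq: "v' t = - gap_weight *\<^sub>R l' t + (\<theta> * t * \<beta> t) *\<^sub>R A (w t)"
proof -
  have "A (x t + (\<theta> * t) *\<^sub>R x' t) - b = A (w t)"
    using feasible A by (simp add: w_def z_def bounded_linear.linear linear_diff linear_add)
  then have "l'' t = \<beta> t *\<^sub>R A (w t) - (\<alpha> / t) *\<^sub>R l' t"
    using l_ode[OF t] by (simp add: eq_diff_eq)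
  then have "(\<theta> * t) *\<^sub>R l'' t = (\<theta> * t * \<beta> t) *\<^sub>R A (w t) - (\<theta> * \<alpha>) *\<^sub>R l' t"
    using t_pos by (simp add: scaleR_diff_right)
  then show ?thesis
    unfolding v'_def by (simp add: gap_weight_def algebra_simps)
qed

text \<open>The coupling terms between \<open>w\<close> and \<open>v\<close> cancel.\<close>

lemma energy'_eq:
  "energy' t = \<theta> * t * (\<theta> * (2 * \<beta> t + t * \<beta>' t)) * (gap t + \<epsilon> t / 2 * (norm (x t))\<^sup>2)
     - \<theta> * t * \<beta> t * (gradf (x t) \<bullet> z t + ls \<bullet> A (z t) + \<rho> * (norm (A (z t)))\<^sup>2 + \<epsilon> t * (x t \<bullet> z t))
     + \<theta>\<^sup>2 * t\<^sup>2 * \<beta> t * \<epsilon>' t / 2 * (norm (x t))\<^sup>2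
     - gap_weight * \<theta> * t * ((norm (x' t))\<^sup>2 + (norm (l' t))\<^sup>2)"
proof -
  have Aw: "A (w t) = A (z t) + (\<theta> * t) *\<^sub>R A (x' t)"
    using A by (simp add: w_def bounded_linear.linear linear_add linear_scale)
  have "w t \<bullet> w' t = - gap_weight * (w t \<bullet> x' t) - \<theta> * t * \<beta> t *
      (w t \<bullet> gradf (x t) + A (w t) \<bullet> ls + A (w t) \<bullet> v t + \<rho> * (A (w t) \<bullet> A (z t)) + \<epsilon> t * (w t \<bullet> x t))"
    unfolding w'_eq by (simp add: inner_diff_right inner_add_right adj)
  moreover have "v t \<bullet> v' t = - gap_weight * (v t \<bullet> l' t) + \<theta> * t * \<beta> t * (A (w t) \<bullet> v t)"
    unfolding v'_eq by (simp add: inner_diff_right inner_add_right inner_commute[of "A (w t)"])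
  moreover have "w t \<bullet> x' t = z t \<bullet> x' t + \<theta> * t * (norm (x' t))\<^sup>2"
    "v t \<bullet> l' t = y t \<bullet> l' t + \<theta> * t * (norm (l' t))\<^sup>2"
    by (simp_all add: w_def v_def inner_add_left power2_norm_eq_inner)
  \<comment> \<open>The parts with \<open>x' t\<close> here and in the next identities make up
    \<open>\<theta> * t * (gap' t + \<epsilon> t * (x t \<bullet> x' t))\<close>, which cancels
    against the derivative of the weighted gap.\<close>
  moreover have "w t \<bullet> gradf (x t) = gradf (x t) \<bullet> z t + \<theta> * t * (gradf (x t) \<bullet> x' t)"
    "w t \<bullet> x t = x t \<bullet> z t + \<theta> * t * (x t \<bullet> x' t)"
    by (simp_all add: w_def inner_add inner_commute)
  moreover have "A (w t) \<bullet> ls = ls \<bullet> A (z t) + \<theta> * t * (ls \<bullet> A (x' t))"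
    "A (w t) \<bullet> A (z t) = (norm (A (z t)))\<^sup>2 + \<theta> * t * (A (z t) \<bullet> A (x' t))"
    by (simp_all add: Aw inner_add inner_commute power2_norm_eq_inner)
  ultimately show ?thesis
    unfolding energy'_def gap'_def by (simp add: algebra_simps power2_eq_square)
qed

lemma energy'_le:
  "energy' t \<le> t * \<beta> t * \<epsilon> t * (\<theta> / 2 * (norm xs)\<^sup>2)
     - (\<theta> * t * ((1 - 2 * \<theta>) * \<beta> t - \<theta> * (t * \<beta>' t)) * gap t
        + \<theta> * t * \<beta> t * (\<rho> / 2 * (norm (A (z t)))\<^sup>2)
        + gap_weight * \<theta> * t * ((norm (x' t))\<^sup>2 + (norm (l' t))\<^sup>2))"
proof -
  have pos: "\<theta> * t * \<beta> t > 0" using theta_pos t_pos beta_pos[OF t] by simp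
  have "f (x t) + gradf (x t) \<bullet> (xs - x t) \<le> f xs"
    by (rule convex_on_imp_above_tangent_GDERIV[OF f_convex f_grad])
  then have "f (x t) - f xs \<le> gradf (x t) \<bullet> z t"
    by (simp add: z_def inner_diff)
  \<comment> \<open>This identity splits the regularization term: the part with \<open>x t\<close>
    joins the energy, the part with \<open>xs\<close> becomes the forcing, and the part with
    \<open>z t\<close> is dropped.\<close>
  moreover have "x t \<bullet> z t = (norm (x t))\<^sup>2 / 2 - (norm xs)\<^sup>2 / 2 + (norm (z t))\<^sup>2 / 2"
    by (simp add: z_def power2_norm_eq_inner inner_diff inner_commute field_simps)
  then have "\<epsilon> t * ((norm (x t))\<^sup>2 / 2 - (norm xs)\<^sup>2 / 2) \<le> \<epsilon> t * (x t \<bullet> z t)"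
    using eps_nonneg[OF t] by (intro mult_left_mono) simp_all
  ultimately have "gap t + \<rho> / 2 * (norm (A (z t)))\<^sup>2 + \<epsilon> t * ((norm (x t))\<^sup>2 / 2 - (norm xs)\<^sup>2 / 2)
      \<le> gradf (x t) \<bullet> z t + ls \<bullet> A (z t) + \<rho> * (norm (A (z t)))\<^sup>2 + \<epsilon> t * (x t \<bullet> z t)"
    unfolding gap_def by simp
  then have 1: "\<theta> * t * \<beta> t * (gap t + \<rho> / 2 * (norm (A (z t)))\<^sup>2 + \<epsilon> t * ((norm (x t))\<^sup>2 / 2 - (norm xs)\<^sup>2 / 2))
      \<le> \<theta> * t * \<beta> t * (gradf (x t) \<bullet> z t + ls \<bullet> A (z t) + \<rho> * (norm (A (z t)))\<^sup>2 + \<epsilon> t * (x t \<bullet> z t))"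
    using pos by (intro mult_left_mono) auto
  \<comment> \<open>Facts \<open>2\<close> and \<open>3\<close> discard two terms by sign, from the
    monotonicity of \<open>\<epsilon>\<close> and from the growth condition.\<close>
  have 2: "\<theta>\<^sup>2 * t\<^sup>2 * \<beta> t * \<epsilon>' t / 2 * (norm (x t))\<^sup>2 \<le> 0"
    using eps_deriv_nonpos[OF t] beta_pos[OF t] by (simp add: mult_nonneg_nonpos mult_nonpos_nonneg)
  have 3: "0 \<le> \<theta> * t * ((1 - 2 * \<theta>) * \<beta> t - \<theta> * (t * \<beta>' t)) * (\<epsilon> t / 2 * (norm (x t))\<^sup>2)"
    using beta_growth[OF t] eps_nonneg[OF t] theta_pos t_pos by simp
  show ?thesis
    unfolding energy'_eq using 1 2 3 by (simp add: algebra_simps)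
qed

end

section \<open>Boundedness and the integral estimates\<close>

definition dissipation where
  "dissipation t = \<theta> * t * ((1 - 2 * \<theta>) * \<beta> t - \<theta> * (t * \<beta>' t)) * gap t
        + \<theta> * t * \<beta> t * (\<rho> / 2 * (norm (A (z t)))\<^sup>2)
        + gap_weight * \<theta> * t * ((norm (x' t))\<^sup>2 + (norm (l' t))\<^sup>2)"

lemma dissipation_terms_nonneg:
  assumes "t \<ge> t0"
  shows "0 \<le> \<theta> * t * ((1 - 2 * \<theta>) * \<beta> t - \<theta> * (t * \<beta>' t)) * gap t"
    and "0 \<le> \<theta> * t * \<beta> t * (\<rho> / 2 * (norm (A (z t)))\<^sup>2)"
    and "0 \<le> gap_weight * \<theta> * t * ((norm (x' t))\<^sup>2 + (norm (l' t))\<^sup>2)"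
  using beta_growth[OF assms] beta_pos[OF assms] theta_pos t_pos[OF assms] rho gap_weight_nonneg
    gap_nonneg[of t]
  by (auto intro!: mult_nonneg_nonneg)

definition forcing where
  "forcing t = t * \<beta> t * \<epsilon> t * (\<theta> / 2 * (norm xs)\<^sup>2)"

lemma forcing_integrable: "set_integrable lborel {t0..} forcing"
  unfolding forcing_def[abs_def] using eps_integrable by simp

lemma forcing_nonneg: "t \<ge> t0 \<Longrightarrow> 0 \<le> forcing t"
  using t_pos[of t] beta_pos[of t] eps_nonneg[of t] theta_pos by (simp add: forcing_def)

lemma energy_bounded:
  obtains E0 where "\<And>t. t \<ge> t0 \<Longrightarrow> energy t \<le> E0"
proof
  fix T assume "T \<ge> t0"
  have "energy' t \<le> forcing t - 0" if "t \<ge> t0" for t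
    using energy'_le[OF that] dissipation_terms_nonneg[OF that] unfolding forcing_def by linarith
  from dissipation_integral_bound[OF energy_deriv this _ forcing_integrable forcing_nonneg \<open>T \<ge> t0\<close>]
  show "energy T \<le> energy t0 + (LINT t:{t0..}|lborel. forcing t)" by simp
qed

text \<open>Accepts any continuous nonnegative minorant of the dissipation, so its summands can be
  extracted one at a time.\<close>

lemma dissipated_integrable:
  assumes "continuous_on {t0..} g" "\<And>t. t \<ge> t0 \<Longrightarrow> 0 \<le> g t" "\<And>t. t \<ge> t0 \<Longrightarrow> g t \<le> dissipation t"
  shows "set_integrable lborel {t0..} g"
proof (rule dissipation_integrable[OF energy_deriv energy_nonneg assms(2) _ assms(1)
      forcing_integrable forcing_nonneg])
  show "energy' t \<le> forcing t - g t" if "t \<ge> t0" for t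
    using energy'_le[OF that] assms(3)[OF that] unfolding forcing_def dissipation_def by linarith
qed

lemma continuous_trajectory:
  "continuous_on {t0..} x" "continuous_on {t0..} x'" "continuous_on {t0..} l'"
  "continuous_on {t0..} (\<lambda>t. A (z t))" "continuous_on {t0..} \<beta>" "continuous_on {t0..} \<epsilon>"
  "continuous_on {t0..} gap"
  unfolding continuous_on_eq_continuous_within
  using has_vector_derivative_continuous[OF x_deriv] has_vector_derivative_continuous[OF x'_deriv]
    has_vector_derivative_continuous[OF l'_deriv] has_vector_derivative_continuous[OF Az_deriv]
    DERIV_continuous[OF beta_deriv] DERIV_continuous[OF eps_deriv] DERIV_continuous[OF gap_deriv]
  by auto

lemma trajectory_bounds:
  "\<exists>C. \<forall>t\<ge>t0. norm (z t) \<le> C \<and> norm (y t) \<le> C \<and> t * norm (x' t) \<le> C \<and> t * norm (l' t) \<le> C"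
proof -
  obtain E0 where E0: "\<And>t. t \<ge> t0 \<Longrightarrow> energy t \<le> E0" using energy_bounded by blast
  define K where "K = sqrt (2 * E0)"
  have w: "norm (w t) \<le> K" and v: "norm (v t) \<le> K" if "t \<ge> t0" for t
    using energy_ge(2,3)[OF that] E0[OF that] unfolding K_def by (auto intro!: real_le_rsqrt)
  define D where "D = max K (max (norm (z t0)) (norm (y t0)))"
  have z: "norm (z t) \<le> D" if "t \<ge> t0" for t
    using bounded_from_extrapolation[OF z_deriv w[unfolded w_def] theta_pos t0_pos that]
    by (simp add: D_def)
  have y: "norm (y t) \<le> D" if "t \<ge> t0" for t
    using bounded_from_extrapolation[OF y_deriv v[unfolded v_def] theta_pos t0_pos that]
    by (simp add: D_def)
  have D: "K \<le> D" by (simp add: D_def)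
  \<comment> \<open>The scaled velocity is the extrapolated point minus the position. A free type
    variable lets the bound serve both components.\<close>
  have scaled: "t * norm q \<le> 2 * D / \<theta>"
    if "t \<ge> t0" "norm p \<le> D" "norm (p + (\<theta> * t) *\<^sub>R q) \<le> K" for t and p q :: "'c::real_inner"
  proof -
    have "norm ((\<theta> * t) *\<^sub>R q) \<le> 2 * D"
      using norm_triangle_ineq4[of "p + (\<theta> * t) *\<^sub>R q" p] that D by simp
    then show ?thesis using theta_pos t_pos[OF that(1)] by (simp add: field_simps)
  qed
  show ?thesis
  proof (intro exI allI impI conjI)
    fix t assume t: "t \<ge> t0"
    show "norm (z t) \<le> max D (2 * D / \<theta>)" "norm (y t) \<le> max D (2 * D / \<theta>)"
      using z[OF t] y[OF t] by simp_all
    show "t * norm (x' t) \<le> max D (2 * D / \<theta>)" "t * norm (l' t) \<le> max D (2 * D / \<theta>)"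
      using scaled[OF t z[OF t] w[OF t, unfolded w_def]] scaled[OF t y[OF t] v[OF t, unfolded v_def]]
      by (simp_all add: le_max_iff_disj)
  qed
qed

lemma trajectory_bounded: "bounded ((\<lambda>t. (x t, l t)) ` {t0..})"
proof -
  obtain C where C: "\<And>t. t \<ge> t0 \<Longrightarrow>
      norm (z t) \<le> C \<and> norm (y t) \<le> C \<and> t * norm (x' t) \<le> C \<and> t * norm (l' t) \<le> C"
    using trajectory_bounds by blast
  have "norm (x t, l t) \<le> C + norm xs + (C + norm ls)" if "t \<ge> t0" for t
    using norm_Pair_le[of "x t" "l t"] C[OF that] norm_triangle_ineq[of "z t" xs]
      norm_triangle_ineq[of "y t" ls]
    by (simp add: z_def y_def)
  then show ?thesis by (auto simp: bounded_iff)
qed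

lemma residual_integrable:
  assumes "\<rho> \<noteq> 0"
  shows "set_integrable lborel {t0..} (\<lambda>t. t * \<beta> t * (norm (A (z t)))\<^sup>2)"
proof -
  have "set_integrable lborel {t0..} (\<lambda>t. \<theta> * t * \<beta> t * (\<rho> / 2 * (norm (A (z t)))\<^sup>2))"
    by (rule dissipated_integrable)
      (use dissipation_terms_nonneg in \<open>auto intro!: continuous_intros continuous_trajectory simp: dissipation_def\<close>)
  then have "set_integrable lborel {t0..} (\<lambda>t. (\<theta> * \<rho> / 2) * (t * \<beta> t * (norm (A (z t)))\<^sup>2))"
    by (simp add: algebra_simps)
  then show ?thesis
    using assms theta_pos by (subst (asm) set_integrable_mult_right_iff) auto
qed

lemma velocity_integrable:
  assumes "gap_weight \<noteq> 0"
  shows "set_integrable lborel {t0..} (\<lambda>t. t * ((norm (x' t))\<^sup>2 + (norm (l' t))\<^sup>2))"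
proof -
  have "set_integrable lborel {t0..} (\<lambda>t. gap_weight * \<theta> * t * ((norm (x' t))\<^sup>2 + (norm (l' t))\<^sup>2))"
    by (rule dissipated_integrable)
      (use dissipation_terms_nonneg in \<open>auto intro!: continuous_intros continuous_trajectory simp: dissipation_def\<close>)
  then have "set_integrable lborel {t0..} (\<lambda>t. (gap_weight * \<theta>) * (t * ((norm (x' t))\<^sup>2 + (norm (l' t))\<^sup>2)))"
    by (simp add: mult.assoc)
  then show ?thesis
    using assms theta_pos by (subst (asm) set_integrable_mult_right_iff) auto
qed

text \<open>Since \<open>x\<close> is bounded, a constant multiple of the integrable
  \<open>t * \<beta> t * \<epsilon> t\<close> dominates.\<close>

lemma regularization_integrable:
  "set_integrable lborel {t0..} (\<lambda>t. t * \<beta> t * \<epsilon> t * (norm (x t))\<^sup>2)"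
proof -
  obtain C where C: "\<And>t. t \<ge> t0 \<Longrightarrow>
      norm (z t) \<le> C \<and> norm (y t) \<le> C \<and> t * norm (x' t) \<le> C \<and> t * norm (l' t) \<le> C"
    using trajectory_bounds by blast
  have nonneg: "0 \<le> t * \<beta> t * \<epsilon> t" if "t \<ge> t0" for t
    using t_pos[OF that] beta_pos[OF that] eps_nonneg[OF that] by simp
  show ?thesis
  proof (rule set_integrable_domination_continuous[OF _ eps_integrable])
    show "continuous_on {t0..} (\<lambda>t. t * \<beta> t * \<epsilon> t * (norm (x t))\<^sup>2)"
      by (intro continuous_intros continuous_trajectory)
    fix t assume t: "t \<ge> t0"
    have "norm (x t) \<le> C + norm xs"
      using C[OF t] norm_triangle_ineq[of "z t" xs] by (simp add: z_def)
    then have "t * \<beta> t * \<epsilon> t * (norm (x t))\<^sup>2 \<le> t * \<beta> t * \<epsilon> t * (C + norm xs)\<^sup>2"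
      using nonneg[OF t] by (intro mult_left_mono power_mono) auto
    then show "t * \<beta> t * \<epsilon> t * (norm (x t))\<^sup>2 \<le> (C + norm xs)\<^sup>2 * (t * \<beta> t * \<epsilon> t)"
      by (simp add: mult.commute)
    show "0 \<le> t * \<beta> t * \<epsilon> t * (norm (x t))\<^sup>2" using nonneg[OF t] by simp
  qed
qed

section \<open>Decay rates\<close>

lemma gap_decay:
  obtains K where "\<And>t. t \<ge> t0 \<Longrightarrow> gap t \<le> K * (1 / (t\<^sup>2 * \<beta> t))"
proof -
  obtain E0 where E0: "\<And>t. t \<ge> t0 \<Longrightarrow> energy t \<le> E0" using energy_bounded by blast
  show thesis
  proof
    fix t assume t: "t \<ge> t0"
    have "\<theta>\<^sup>2 * (t\<^sup>2 * \<beta> t * gap t) \<le> E0" using energy_ge(1)[OF t] E0[OF t] by linarith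
    then show "gap t \<le> E0 / \<theta>\<^sup>2 * (1 / (t\<^sup>2 * \<beta> t))"
      using theta_pos t_pos[OF t] beta_pos[OF t] by (simp add: field_simps)
  qed
qed

text \<open>The multiplier equation reads \<open>\<theta> g' + a g = h'\<close> with \<open>g = t\<^sup>2 \<beta> A z\<close>, \<open>h = t l' + (\<alpha> - 1) y\<close>
  and \<open>a \<ge> 0\<close>, so \<open>G = g - h / \<theta>\<close> satisfies \<open>\<theta> G' = - a (G + h / \<theta>)\<close> with \<open>h\<close> bounded.\<close>

lemma residual_decay:
  obtains K where "\<And>t. t \<ge> t0 \<Longrightarrow> norm (A (z t)) \<le> K * (1 / (t\<^sup>2 * \<beta> t))"
proof -
  obtain C where C: "\<And>t. t \<ge> t0 \<Longrightarrow>
      norm (z t) \<le> C \<and> norm (y t) \<le> C \<and> t * norm (x' t) \<le> C \<and> t * norm (l' t) \<le> C"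
    using trajectory_bounds by blast
  \<comment> \<open>The factor \<open>1 / \<theta>\<close> is already included in this
    \<open>h\<close>, so \<open>G\<close> subtracts it directly.\<close>
  define h where "h t = (1 / \<theta>) *\<^sub>R (t *\<^sub>R l' t + (\<alpha> - 1) *\<^sub>R y t)" for t
  define G where "G t = (t\<^sup>2 * \<beta> t) *\<^sub>R A (z t) - h t" for t
  \<comment> \<open>Chosen so that the derivative of \<open>G\<close> is
    \<open>- \<kappa> t *\<^sub>R A (z t)\<close>; the growth condition makes it
    nonnegative.\<close>
  define \<kappa> where "\<kappa> t = t * ((1 - 2 * \<theta>) * \<beta> t - \<theta> * (t * \<beta>' t)) / \<theta>" for t
  define H where "H = \<alpha> * C / \<theta>"
  have h: "norm (h t) \<le> H" if t: "t \<ge> t0" for t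
  proof -
    have "norm (t *\<^sub>R l' t + (\<alpha> - 1) *\<^sub>R y t) \<le> C + (\<alpha> - 1) * C"
    proof (rule norm_triangle_mono)
      show "norm (t *\<^sub>R l' t) \<le> C" using C[OF t] t_pos[OF t] by simp
      show "norm ((\<alpha> - 1) *\<^sub>R y t) \<le> (\<alpha> - 1) * C"
        using C[OF t] alpha by (simp add: mult_left_mono)
    qed
    also have "C + (\<alpha> - 1) * C = \<alpha> * C" by (simp add: algebra_simps)
    finally have "norm (t *\<^sub>R l' t + (\<alpha> - 1) *\<^sub>R y t) / \<theta> \<le> H"
      unfolding H_def using theta_pos by (intro divide_right_mono) auto
    then show ?thesis using theta_pos by (simp add: h_def)
  qed
  have G_deriv: "(G has_vector_derivative - \<kappa> t *\<^sub>R A (z t)) (at t within {t0..})" if t: "t \<ge> t0" for t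
  proof -
    have 1: "((\<lambda>t. t\<^sup>2 * \<beta> t) has_real_derivative 2 * t * \<beta> t + t\<^sup>2 * \<beta>' t) (at t within {t0..})"
      by (auto intro!: derivative_eq_intros beta_deriv t)
    have 2: "((\<lambda>t. t *\<^sub>R l' t + (\<alpha> - 1) *\<^sub>R y t) has_vector_derivative
        (t *\<^sub>R l'' t + l' t) + (\<alpha> - 1) *\<^sub>R l' t) (at t within {t0..})"
      by (rule has_vector_derivative_eq_rhs, (rule derivative_intros y_deriv l'_deriv t)+) simp
    have "(t *\<^sub>R l'' t + l' t) + (\<alpha> - 1) *\<^sub>R l' t = t *\<^sub>R (l'' t + (\<alpha> / t) *\<^sub>R l' t)"
      using t_pos[OF t] by (simp add: algebra_simps)
    also have "\<dots> = (t * \<beta> t) *\<^sub>R (A (z t) + (\<theta> * t) *\<^sub>R A (x' t))"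
      using feasible A unfolding l_ode[OF t]
      by (simp add: z_def bounded_linear.linear linear_diff linear_add linear_scale)
    finally have 3: "(h has_vector_derivative (1 / \<theta>) *\<^sub>R ((t * \<beta> t) *\<^sub>R (A (z t) + (\<theta> * t) *\<^sub>R A (x' t))))
        (at t within {t0..})"
      using has_vector_derivative_scaleR[OF DERIV_const[of "1 / \<theta>"] 2] by (simp add: h_def[abs_def])
    have "(1 / \<theta>) *\<^sub>R ((t * \<beta> t) *\<^sub>R (A (z t) + (\<theta> * t) *\<^sub>R A (x' t)))
        = (t * \<beta> t / \<theta>) *\<^sub>R A (z t) + (t\<^sup>2 * \<beta> t) *\<^sub>R A (x' t)"
      using theta_pos by (simp add: scaleR_add_right power2_eq_square ac_simps)
    note 3 = 3[unfolded this]
    \<comment> \<open>Subtracting \<open>h\<close> pays off here: the two \<open>A (x' t)\<close>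
      terms cancel and a multiple of \<open>A (z t)\<close> remains.\<close>
    have "(G has_vector_derivative (t\<^sup>2 * \<beta> t) *\<^sub>R A (x' t) + (2 * t * \<beta> t + t\<^sup>2 * \<beta>' t) *\<^sub>R A (z t)
        - ((t * \<beta> t / \<theta>) *\<^sub>R A (z t) + (t\<^sup>2 * \<beta> t) *\<^sub>R A (x' t))) (at t within {t0..})"
      unfolding G_def[abs_def]
      by (rule has_vector_derivative_diff[OF has_vector_derivative_scaleR[OF 1 Az_deriv[OF t]] 3])
    moreover have "2 * t * \<beta> t + t\<^sup>2 * \<beta>' t - t * \<beta> t / \<theta> = - \<kappa> t"
      using theta_pos by (simp add: \<kappa>_def field_simps power2_eq_square)
    then have "(2 * t * \<beta> t + t\<^sup>2 * \<beta>' t) *\<^sub>R A (z t) - (t * \<beta> t / \<theta>) *\<^sub>R A (z t) = - \<kappa> t *\<^sub>R A (z t)"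
      by (simp only: scaleR_diff_left[symmetric])
    then have "(t\<^sup>2 * \<beta> t) *\<^sub>R A (x' t) + (2 * t * \<beta> t + t\<^sup>2 * \<beta>' t) *\<^sub>R A (z t)
        - ((t * \<beta> t / \<theta>) *\<^sub>R A (z t) + (t\<^sup>2 * \<beta> t) *\<^sub>R A (x' t)) = - \<kappa> t *\<^sub>R A (z t)"
      by (metis add_diff_cancel_left add.commute)
    ultimately show ?thesis by (simp only:)
  qed
  have G: "(norm (G t))\<^sup>2 \<le> max (H\<^sup>2) ((norm (G t0))\<^sup>2)" if t: "t \<ge> t0" for t
  proof (rule barrier_bound[OF norm_sq_deriv[OF G_deriv] _ t])
    fix s assume s: "s \<ge> t0" and ge: "(norm (G s))\<^sup>2 \<ge> H\<^sup>2"
    have "H \<le> norm (G s)" by (rule power2_le_imp_le[OF ge]) simp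
    then have "norm (G s) * norm (h s) \<le> norm (G s) * norm (G s)"
      using h[OF s] by (intro mult_left_mono) auto
    \<comment> \<open>Outside the ball of radius \<open>H\<close>, \<open>G s\<close> dominates
      \<open>h s\<close>. As \<open>G s + h s\<close> is a positive multiple of
      \<open>A (z s)\<close>, the velocity of \<open>G\<close> does not point outwards.\<close>
    then have "0 \<le> G s \<bullet> G s + G s \<bullet> h s"
      using Cauchy_Schwarz_ineq2[of "G s" "h s"]
      by (simp add: power2_norm_eq_inner[symmetric] power2_eq_square)
    also have "G s \<bullet> G s + G s \<bullet> h s = s\<^sup>2 * \<beta> s * (G s \<bullet> A (z s))"
      unfolding inner_add_right[symmetric] by (simp add: G_def)
    finally have "0 \<le> s\<^sup>2 * \<beta> s * (G s \<bullet> A (z s))" .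
    moreover have "0 < s\<^sup>2 * \<beta> s" using t_pos[OF s] beta_pos[OF s] by simp
    ultimately have "0 \<le> G s \<bullet> A (z s)" by (meson mult_pos_neg not_le)
    moreover have "0 \<le> \<kappa> s"
      using beta_growth[OF s] t_pos[OF s] theta_pos by (simp add: \<kappa>_def)
    ultimately show "2 * (G s \<bullet> (- \<kappa> s *\<^sub>R A (z s))) \<le> 0" by simp
  qed
  define M where "M = sqrt (max (H\<^sup>2) ((norm (G t0))\<^sup>2))"
  show thesis
  proof
    fix t assume t: "t \<ge> t0"
    have "norm (G t) \<le> M" unfolding M_def by (rule real_le_rsqrt[OF G[OF t]])
    then have "norm ((t\<^sup>2 * \<beta> t) *\<^sub>R A (z t)) \<le> M + H"
      using h[OF t] norm_triangle_ineq[of "G t" "h t"] by (simp add: G_def)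
    then show "norm (A (z t)) \<le> (M + H) * (1 / (t\<^sup>2 * \<beta> t))"
      using t_pos[OF t] beta_pos[OF t] by (simp add: field_simps)
  qed
qed

lemma inverse_rate_nonneg: "t \<ge> t0 \<Longrightarrow> 0 \<le> 1 / (t\<^sup>2 * \<beta> t)"
  using beta_pos[of t] by simp

lemma lagrangian_rate:
  "(\<lambda>t. f (x t) - f xs + ls \<bullet> A (z t)) \<in> O[at_top](\<lambda>t. 1 / (t\<^sup>2 * \<beta> t))"
proof -
  obtain K where K: "\<And>t. t \<ge> t0 \<Longrightarrow> gap t \<le> K * (1 / (t\<^sup>2 * \<beta> t))" using gap_decay by blast
  show ?thesis
  proof (rule bigo_at_top_I[OF _ inverse_rate_nonneg])
    show "\<bar>f (x t) - f xs + ls \<bullet> A (z t)\<bar> \<le> K * (1 / (t\<^sup>2 * \<beta> t))" if "t \<ge> t0" for t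
      using K[OF that] gap_ge[of t] lagrangian_gap_nonneg[of t] by linarith
  qed
qed

lemma residual_rate: "(\<lambda>t. norm (A (z t))) \<in> O[at_top](\<lambda>t. 1 / (t\<^sup>2 * \<beta> t))"
proof -
  obtain K where "\<And>t. t \<ge> t0 \<Longrightarrow> norm (A (z t)) \<le> K * (1 / (t\<^sup>2 * \<beta> t))"
    using residual_decay by blast
  then show ?thesis by (intro bigo_at_top_I[OF _ inverse_rate_nonneg]) auto
qed

text \<open>The objective error is the Lagrangian gap minus the multiplier term, and the latter
  inherits the rate of the residual.\<close>

lemma objective_rate: "(\<lambda>t. \<bar>f (x t) - f xs\<bar>) \<in> O[at_top](\<lambda>t. 1 / (t\<^sup>2 * \<beta> t))"
proof -
  have "(\<lambda>t. ls \<bullet> A (z t)) \<in> O[at_top](\<lambda>t. norm (A (z t)))"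
    by (rule bigoI[where c = "norm ls"]) (simp add: Cauchy_Schwarz_ineq2)
  then have "(\<lambda>t. ls \<bullet> A (z t)) \<in> O[at_top](\<lambda>t. 1 / (t\<^sup>2 * \<beta> t))"
    using residual_rate by (rule landau_o.big_trans)
  from sum_in_bigo(2)[OF lagrangian_rate this] show ?thesis by simp
qed

lemma velocity_rate: "(\<lambda>t. norm (x' t, l' t)) \<in> O[at_top](\<lambda>t. 1 / t)"
proof -
  obtain C where C: "\<And>t. t \<ge> t0 \<Longrightarrow>
      norm (z t) \<le> C \<and> norm (y t) \<le> C \<and> t * norm (x' t) \<le> C \<and> t * norm (l' t) \<le> C"
    using trajectory_bounds by blast
  show ?thesis
  proof (rule bigo_at_top_I)
    fix t assume t: "t \<ge> t0"
    have "t * norm (x' t, l' t) \<le> t * (norm (x' t) + norm (l' t))"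
      using t_pos[OF t] norm_Pair_le by (intro mult_left_mono) auto
    also have "\<dots> \<le> 2 * C" using C[OF t] by (simp add: distrib_left)
    finally show "\<bar>norm (x' t, l' t)\<bar> \<le> 2 * C * (1 / t)"
      using t_pos[OF t] by (simp add: field_simps)
    show "0 \<le> 1 / t" using t_pos[OF t] by simp
  qed
qed

lemma gradient_sq_le: "(norm (gradf (x t) - gradf xs))\<^sup>2 \<le> 2 * L * gap t"
  using cocoercive_gap[of t] mult_left_mono[OF gap_ge[of t], of "2 * L"] L_pos by linarith

text \<open>Cocoercivity bounds the square by the gap, so the rate is the square root of the gap
  rate.\<close>

lemma gradient_rate:
  "(\<lambda>t. norm (gradf (x t) - gradf xs)) \<in> O[at_top](\<lambda>t. 1 / (t * sqrt (\<beta> t)))"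
proof -
  obtain K where K: "\<And>t. t \<ge> t0 \<Longrightarrow> gap t \<le> K * (1 / (t\<^sup>2 * \<beta> t))" using gap_decay by blast
  show ?thesis
  proof (rule bigo_at_top_I)
    fix t assume t: "t \<ge> t0"
    have "(norm (gradf (x t) - gradf xs))\<^sup>2 \<le> 2 * L * (K * (1 / (t\<^sup>2 * \<beta> t)))"
      using gradient_sq_le[of t] mult_left_mono[OF K[OF t], of "2 * L"] L_pos by linarith
    then have "norm (gradf (x t) - gradf xs) \<le> sqrt (2 * L * (K * (1 / (t\<^sup>2 * \<beta> t))))"
      by (rule real_le_rsqrt)
    also have "\<dots> = sqrt (2 * L * K) * (1 / (t * sqrt (\<beta> t)))"
      using t_pos[OF t] by (simp add: real_sqrt_mult real_sqrt_divide)
    finally show "\<bar>norm (gradf (x t) - gradf xs)\<bar> \<le> sqrt (2 * L * K) * (1 / (t * sqrt (\<beta> t)))"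
      by simp
    show "0 \<le> 1 / (t * sqrt (\<beta> t))" using t_pos[OF t] beta_pos[OF t] by simp
  qed
qed

section \<open>Integral estimates under strict growth\<close>

context
  fixes d :: real
  assumes d: "d > 0"
    and strict_growth: "\<And>t. t \<ge> t0 \<Longrightarrow> \<theta> * (t * \<beta>' t) \<le> (1 - 2 * \<theta> - d) * \<beta> t"
begin

text \<open>The margin \<open>d\<close> keeps the coefficient of \<open>gap t\<close> in the
  dissipation above \<open>\<theta> * t * (d * \<beta> t)\<close>.\<close>

lemma gap_integrable: "set_integrable lborel {t0..} (\<lambda>t. t * \<beta> t * gap t)"
proof -
  have "set_integrable lborel {t0..} (\<lambda>t. \<theta> * t * (d * \<beta> t) * gap t)"
  proof (rule dissipated_integrable)
    show "continuous_on {t0..} (\<lambda>t. \<theta> * t * (d * \<beta> t) * gap t)"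
      by (intro continuous_intros continuous_trajectory)
    fix t assume t: "t \<ge> t0"
    show "0 \<le> \<theta> * t * (d * \<beta> t) * gap t"
      using theta_pos t_pos[OF t] d beta_pos[OF t] gap_nonneg[of t] by simp
    have "d * \<beta> t \<le> (1 - 2 * \<theta>) * \<beta> t - \<theta> * (t * \<beta>' t)"
      using strict_growth[OF t] by (simp add: algebra_simps)
    then have "\<theta> * t * (d * \<beta> t) * gap t \<le> \<theta> * t * ((1 - 2 * \<theta>) * \<beta> t - \<theta> * (t * \<beta>' t)) * gap t"
      using theta_pos t_pos[OF t] gap_nonneg[of t] by (intro mult_right_mono mult_left_mono) auto
    then show "\<theta> * t * (d * \<beta> t) * gap t \<le> dissipation t"
      using dissipation_terms_nonneg[OF t] unfolding dissipation_def by linarith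
  qed
  then have "set_integrable lborel {t0..} (\<lambda>t. (\<theta> * d) * (t * \<beta> t * gap t))"
    by (simp add: algebra_simps)
  then show ?thesis
    using d theta_pos by (subst (asm) set_integrable_mult_right_iff) auto
qed

lemma gradient_integrable:
  "set_integrable lborel {t0..} (\<lambda>t. t * \<beta> t * (norm (gradf (x t) - gradf xs))\<^sup>2)"
proof (rule set_integrable_domination_continuous[OF _ gap_integrable])
  have "continuous_on {t0..} (\<lambda>t. gradf (x t))"
    using continuous_on_compose2[OF lipschitz_on_continuous_on[OF gradf_lipschitz]
        continuous_trajectory(1)] by simp
  then show "continuous_on {t0..} (\<lambda>t. t * \<beta> t * (norm (gradf (x t) - gradf xs))\<^sup>2)"
    by (intro continuous_intros continuous_trajectory)
  fix t assume t: "t \<ge> t0"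
  have pos: "0 \<le> t * \<beta> t" using t_pos[OF t] beta_pos[OF t] by simp
  then show "0 \<le> t * \<beta> t * (norm (gradf (x t) - gradf xs))\<^sup>2" by simp
  show "t * \<beta> t * (norm (gradf (x t) - gradf xs))\<^sup>2 \<le> 2 * L * (t * \<beta> t * gap t)"
    using mult_left_mono[OF gradient_sq_le[of t] pos] by (simp add: ac_simps)
qed

end

end

section \<open>Transfer to solutions of the system and saddle points\<close>

theorem theorem3p1:
  fixes f :: "'a::{real_inner, complete_space} \<Rightarrow> real"
    and gradf :: "'a \<Rightarrow> 'a"
    and A :: "'a \<Rightarrow> 'b::{real_inner, complete_space}"
    and b :: 'b
    and L t0 \<alpha> \<theta> \<rho> :: real
    and \<beta> \<beta>' \<epsilon> \<epsilon>' :: "real \<Rightarrow> real"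
    and x x' :: "real \<Rightarrow> 'a" and l l' :: "real \<Rightarrow> 'b"
    and xs :: 'a and ls :: 'b
  assumes A: "bounded_linear A"
    and f_convex: "convex_on UNIV f"
    and f_grad: "\<And>u. GDERIV f u :> gradf u"
    and gradf_cont: "continuous_on UNIV gradf"
    and L_pos: "L > 0"
    and gradf_lipschitz: "L-lipschitz_on UNIV gradf"
    and t0_pos: "t0 > 0"
    and eps_nonneg: "\<And>t. t \<ge> t0 \<Longrightarrow> \<epsilon> t \<ge> 0"
    and eps_noninc: "antimono_on {t0..} \<epsilon>"
    and eps_deriv: "\<And>t. t \<ge> t0 \<Longrightarrow> (\<epsilon> has_real_derivative \<epsilon>' t) (at t within {t0..})"
    and eps_C1: "continuous_on {t0..} \<epsilon>'"
    and eps_lim: "(\<epsilon> \<longlongrightarrow> 0) at_top"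
    and beta_pos: "\<And>t. t \<ge> t0 \<Longrightarrow> \<beta> t > 0"
    and beta_deriv: "\<And>t. t \<ge> t0 \<Longrightarrow> (\<beta> has_real_derivative \<beta>' t) (at t within {t0..})"
    and beta_C1: "continuous_on {t0..} \<beta>'"
    and alpha: "\<alpha> > 1"
    and theta: "\<theta> \<ge> 1 / (\<alpha> - 1)"
    and rho: "\<rho> \<ge> 0"
    and saddle_nonempty: "saddle_points (lagrangian f A b) \<noteq> {}"
    and beta_growth: "\<And>t. t \<ge> t0 \<Longrightarrow> t * \<beta>' t \<le> (1 - 2 * \<theta>) / \<theta> * \<beta> t"
    and eps_integrable: "set_integrable lborel {t0..} (\<lambda>t. t * \<beta> t * \<epsilon> t)"
    and beta_lim: "filterlim (\<lambda>t. t\<^sup>2 * \<beta> t) at_top at_top"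
    and solution: "solution_S t0 \<alpha> \<theta> \<rho> \<beta> \<epsilon> gradf A b x x' l l'"
    and saddle: "(xs, ls) \<in> saddle_points (lagrangian f A b)"
  shows "bounded ((\<lambda>t. (x t, l t)) ` {t0..})
    \<and> ((\<rho> \<noteq> 0 \<longrightarrow> set_integrable lborel {t0..} (\<lambda>t. t * \<beta> t * (norm (A (x t) - b))\<^sup>2))
       \<and> set_integrable lborel {t0..} (\<lambda>t. t * \<beta> t * \<epsilon> t * (norm (x t))\<^sup>2)
       \<and> ((\<alpha> - 1) * \<theta> - 1 \<noteq> 0 \<longrightarrow>
            set_integrable lborel {t0..} (\<lambda>t. t * ((norm (x' t))\<^sup>2 + (norm (l' t))\<^sup>2))))
    \<and> ((\<lambda>t. lagrangian f A b (x t) ls - lagrangian f A b xs ls) \<in> O[at_top](\<lambda>t. 1 / (t\<^sup>2 * \<beta> t))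
       \<and> (\<lambda>t. \<bar>f (x t) - f xs\<bar>) \<in> O[at_top](\<lambda>t. 1 / (t\<^sup>2 * \<beta> t))
       \<and> (\<lambda>t. norm (A (x t) - b)) \<in> O[at_top](\<lambda>t. 1 / (t\<^sup>2 * \<beta> t))
       \<and> (\<lambda>t. norm (x' t, l' t)) \<in> O[at_top](\<lambda>t. 1 / t)
       \<and> (\<lambda>t. norm (gradf (x t) - gradf xs)) \<in> O[at_top](\<lambda>t. 1 / (t * sqrt (\<beta> t))))
    \<and> ((SUP t\<in>{t0..}. t * \<beta>' t / \<beta> t) < (1 - 2 * \<theta>) / \<theta> \<longrightarrow>
         set_integrable lborel {t0..}
           (\<lambda>t. t * \<beta> t * (aug_lagrangian \<rho> f A b (x t) ls - aug_lagrangian \<rho> f A b xs ls))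
         \<and> set_integrable lborel {t0..} (\<lambda>t. t * \<beta> t * (norm (gradf (x t) - gradf xs))\<^sup>2))"
proof -
  obtain x'' l'' where sol: "\<And>t. t \<ge> t0 \<Longrightarrow>
       (x has_vector_derivative x' t) (at t within {t0..}) \<and>
       (x' has_vector_derivative x'' t) (at t within {t0..}) \<and>
       (l has_vector_derivative l' t) (at t within {t0..}) \<and>
       (l' has_vector_derivative l'' t) (at t within {t0..}) \<and>
       x'' t + (\<alpha> / t) *\<^sub>R x' t =
         - (\<beta> t *\<^sub>R (gradf (x t) + adjoint A (l t + (\<theta> * t) *\<^sub>R l' t)
                    + \<rho> *\<^sub>R adjoint A (A (x t) - b) + \<epsilon> t *\<^sub>R x t)) \<and>
       l'' t + (\<alpha> / t) *\<^sub>R l' t = \<beta> t *\<^sub>R (A (x t + (\<theta> * t) *\<^sub>R x' t) - b)"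
    using solution unfolding solution_S_def by blast
  have "0 < 1 / (\<alpha> - 1)" using alpha by simp
  then have th: "\<theta> > 0" using theta by linarith
  note adj = adjoint_bounded_linear[OF A]
  interpret primal_dual_trajectory f gradf A "adjoint A" b L t0 \<alpha> \<theta> \<rho> \<beta> \<beta>' \<epsilon> \<epsilon>' x x' x'' l l' l'' xs ls
  proof (rule primal_dual_trajectory.intro)
    show "\<epsilon>' t \<le> 0" if "t \<ge> t0" for t
      using antimono_on_imp_has_real_derivative_nonpos[OF eps_noninc eps_deriv[OF that] that] .
    show "\<theta> * (t * \<beta>' t) \<le> (1 - 2 * \<theta>) * \<beta> t" if "t \<ge> t0" for t
      using mult_left_mono[OF beta_growth[OF that], of \<theta>] th by simp
    show "A xs = b" by (rule saddle_point_feasible[OF saddle])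
    show "gradf xs + adjoint A ls = 0" by (rule saddle_point_stationary[OF saddle A adj f_grad])
  qed (use assms sol adj in \<open>simp_all\<close>)
  have lag: "lagrangian f A b (x t) ls - lagrangian f A b xs ls = f (x t) - f xs + ls \<bullet> A (z t)"
    and aug: "aug_lagrangian \<rho> f A b (x t) ls - aug_lagrangian \<rho> f A b xs ls = gap t" for t
    by (simp_all add: aug_lagrangian_def lagrangian_def residual feasible gap_def)
  have strict: "set_integrable lborel {t0..} (\<lambda>t. t * \<beta> t * gap t)
      \<and> set_integrable lborel {t0..} (\<lambda>t. t * \<beta> t * (norm (gradf (x t) - gradf xs))\<^sup>2)"
    if sup: "(SUP t\<in>{t0..}. t * \<beta>' t / \<beta> t) < (1 - 2 * \<theta>) / \<theta>"
  proof -
    define S where "S = (SUP t\<in>{t0..}. t * \<beta>' t / \<beta> t)"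
    \<comment> \<open>With this margin \<open>1 - 2 * \<theta> - d\<close> equals
      \<open>\<theta> * S\<close>, and the strict inequality for the supremum says that
      \<open>d\<close> is positive.\<close>
    define d where "d = 1 - 2 * \<theta> - \<theta> * S"
    have d: "d > 0" using sup th by (simp add: d_def S_def pos_less_divide_eq mult.commute)
    \<comment> \<open>A real supremum bounds its set only if that set is bounded above; the growth
      condition supplies an upper bound.\<close>
    have "t * \<beta>' t / \<beta> t \<le> (1 - 2 * \<theta>) / \<theta>" if "t \<ge> t0" for t
      using beta_growth[OF that] beta_pos[OF that] th by (simp add: field_simps)
    then have bdd: "bdd_above ((\<lambda>t. t * \<beta>' t / \<beta> t) ` {t0..})" by (auto intro!: bdd_aboveI2)
    have "\<theta> * (t * \<beta>' t) \<le> (1 - 2 * \<theta> - d) * \<beta> t" if t: "t \<ge> t0" for t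
    proof -
      have "t * \<beta>' t / \<beta> t \<le> S" unfolding S_def using t by (intro cSUP_upper bdd) auto
      then have "\<theta> * (t * \<beta>' t) \<le> \<theta> * (S * \<beta> t)"
        using beta_pos[OF t] th by (intro mult_left_mono) (auto simp: pos_divide_le_eq)
      also have "\<dots> = (1 - 2 * \<theta> - d) * \<beta> t" by (simp add: d_def)
      finally show ?thesis .
    qed
    then show ?thesis using gap_integrable[OF d] gradient_integrable[OF d] by blast
  qed
  show ?thesis
    unfolding lag aug residual
    using trajectory_bounded residual_integrable regularization_integrable velocity_integrable
      lagrangian_rate objective_rate residual_rate velocity_rate gradient_rate strict
    by (simp add: gap_weight_def)
qed

end
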